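(* Let $m, n \ge 1$ be integers with $n > m$, and let $A > 0$ be a constant. For each multi-index $\alpha$ with $|\alpha| = m$ let $a_\alpha : \mathbb{R}^n \times \mathbb{R} \to \mathbb{R}$ be a Carathéodory function such that $|a_\alpha(x,\zeta)| \le A|\zeta|$ for almost all $x \in \mathbb{R}^n$ and all $\zeta \in \mathbb{R}$. Let $g : [0,\infty) \to \mathbb{R}$ be a non-decreasing convex function such that $g(\zeta) > 0$ for all $\zeta > 0$. Suppose that $$\int_1^\infty (g(\zeta))^{-1/m}\, \zeta^{1/m - 1}\, d\zeta < \infty$$ and $$\int_0^1 \frac{g(r)\, dr}{r^{1 + n/(n-m)}} = \infty.$$ Then any global weak solution $u$ of the differential inequality $$\sum_{|\alpha| = m} \partial^\alpha a_\alpha(x,u) \ge g(|u|) \quad \text{in } \mathbb{R}^n$$ is trivial, i.e. $u = 0$ almost everywhere in $\mathbb{R}^n$.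
   Context: For a multi-index $\alpha = (\alpha_1,\ldots,\alpha_n)$ of non-negative integers, $|\alpha| = \alpha_1 + \cdots + \alpha_n$ and $\partial^\alpha = \partial^{|\alpha|}/(\partial x_1^{\alpha_1}\cdots\partial x_n^{\alpha_n})$. A Carathéodory function $a(x,\zeta)$ is one that is measurable in $x$ for every $\zeta$ and continuous in $\zeta$ for almost every $x$. A (real-valued) function $u \in L_{1,loc}(\mathbb{R}^n)$ is called a global weak solution of $\sum_{|\alpha|=m}\partial^\alpha a_\alpha(x,u) \ge g(|u|)$ in $\mathbb{R}^n$ if $g(|u|) \in L_{1,loc}(\mathbb{R}^n)$ and $$\int_{\mathbb{R}^n} \sum_{|\alpha| = m} (-1)^m a_\alpha(x,u)\, \partial^\alpha \varphi \, dx \ge \int_{\mathbb{R}^n} g(|u|)\, \varphi \, dx$$ for any non-negative function $\varphi \in C_0^\infty(\mathbb{R}^n)$. *)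

theory Defs
  imports "HOL-Analysis.Analysis"
begin

text \<open>
  The Euclidean space of dimension \<open>n = CARD('n)\<close> is \<open>real ^ 'n\<close>; a multi-index is a
  function \<open>'n \<Rightarrow> nat\<close>.
\<close>

definition partial_deriv :: "'n::finite \<Rightarrow> (real ^ 'n \<Rightarrow> real) \<Rightarrow> real ^ 'n \<Rightarrow> real" where
  "partial_deriv i f x = deriv (\<lambda>t. f (x + t *\<^sub>R axis i 1)) 0"

definition iter_partial :: "'n::finite list \<Rightarrow> (real ^ 'n \<Rightarrow> real) \<Rightarrow> real ^ 'n \<Rightarrow> real" where
  "iter_partial is f = foldr partial_deriv is f"

text \<open>All iterated partial derivatives, in any order of the variables, exist and are continuous.\<close>

definition smooth :: "(real ^ 'n::finite \<Rightarrow> real) \<Rightarrow> bool" where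
  "smooth f \<longleftrightarrow> (\<forall>is. continuous_on UNIV (iter_partial is f) \<and>
     (\<forall>i x. (\<lambda>t::real. iter_partial is f (x + t *\<^sub>R axis i 1)) field_differentiable (at 0)))"

definition mi_size :: "('n::finite \<Rightarrow> nat) \<Rightarrow> nat" where
  "mi_size \<alpha> = (\<Sum>i\<in>UNIV. \<alpha> i)"

text \<open>
  The index type carries no order, so the order of differentiation is an arbitrary one in which
  each variable \<open>i\<close> occurs \<open>\<alpha> i\<close> times. The derivative is only applied to smooth
  functions, for which the order is irrelevant.
\<close>

definition mi_deriv :: "('n::finite \<Rightarrow> nat) \<Rightarrow> (real ^ 'n \<Rightarrow> real) \<Rightarrow> real ^ 'n \<Rightarrow> real" where
  "mi_deriv \<alpha> f = iter_partial (SOME is. \<forall>i. count_list is i = \<alpha> i) f"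

definition test_function :: "(real ^ 'n::finite \<Rightarrow> real) \<Rightarrow> bool" where
  "test_function \<phi> \<longleftrightarrow> smooth \<phi> \<and> compact (closure {x. \<phi> x \<noteq> 0})"

definition L1_loc :: "(real ^ 'n::finite \<Rightarrow> real) \<Rightarrow> bool" where
  "L1_loc u \<longleftrightarrow> (\<forall>K. compact K \<longrightarrow> u absolutely_integrable_on K)"

definition caratheodory :: "(real ^ 'n::finite \<Rightarrow> real \<Rightarrow> real) \<Rightarrow> bool" where
  "caratheodory a \<longleftrightarrow> (\<forall>\<zeta>. (\<lambda>x. a x \<zeta>) \<in> borel_measurable lebesgue) \<and>
     (AE x in lebesgue. continuous_on UNIV (a x))"

text \<open>
  The Bochner integral of a non-integrable function is 0. For Caratheodory functions with
  \<open>\<bar>a \<alpha> x \<zeta>\<bar> \<le> A * \<bar>\<zeta>\<bar>\<close> both integrands below are integrable, because \<open>u\<close> and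
  \<open>g \<bar>u\<bar>\<close> are locally integrable and \<open>\<phi>\<close> is smooth with compact support.
\<close>

definition global_weak_solution ::
    "nat \<Rightarrow> (('n::finite \<Rightarrow> nat) \<Rightarrow> real ^ 'n \<Rightarrow> real \<Rightarrow> real) \<Rightarrow> (real \<Rightarrow> real) \<Rightarrow> (real ^ 'n \<Rightarrow> real) \<Rightarrow> bool"
  where
  "global_weak_solution m a g u \<longleftrightarrow>
     L1_loc u \<and> L1_loc (\<lambda>x. g \<bar>u x\<bar>) \<and>
     (\<forall>\<phi>. test_function \<phi> \<and> (\<forall>x. 0 \<le> \<phi> x) \<longrightarrow>
        (LINT x|lebesgue. (\<Sum>\<alpha> | mi_size \<alpha> = m. (-1) ^ m * a \<alpha> x (u x) * mi_deriv \<alpha> \<phi> x))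
          \<ge> (LINT x|lebesgue. g \<bar>u x\<bar> * \<phi> x))"

end

theory Submission
  imports Defs
begin

text \<open>
  Testing the inequality with a smooth cutoff between the cubes \<open>Q\<^sub>r\<close> and \<open>Q\<^sub>R\<close>
  (\<open>r < R\<close>) bounds \<open>(R - r)\<^sup>m E(r)\<close>, where \<open>E(r)\<close> is the integral of \<open>g(|u|)\<close> over
  \<open>Q\<^sub>r\<close>, by a constant times the integral of \<open>|u|\<close> over
  \<open>Q\<^sub>R - Q\<^sub>r\<close>. Jensen's inequality turns this into
  \<open>E(R) - E(r) \<ge> V g((R - r)\<^sup>m E(r) / (C V))\<close>, where \<open>V\<close> is the volume of the annulus.
  Suppose \<open>E\<close> is not identically zero. On dyadic cubes, divergence of the integral of \<open>g\<close> at
  the origin prevents \<open>r\<^sup>m E(r) / r\<^sup>n\<close> from approaching 0, because passing through all small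
  values would make a negative power of \<open>E\<close> decrease by an infinite amount. Hence \<open>E(r)\<close>
  is at least a fixed multiple of \<open>r\<^sup>n\<close>. From there the integral condition at infinity allows
  \<open>E(r) / r\<^sup>n\<close> to pass the values of \<open>g\<close> at all powers of 2 within a bounded increase of
  \<open>r\<close>, contradicting local integrability.
\<close>

section \<open>Smooth cutoff functions\<close>

text \<open>Quantifying over the derivative lets each closure rule exhibit a formula for it;
  uniqueness of derivatives recovers \<open>deriv\<close> afterwards.\<close>

primrec diff_times :: "nat \<Rightarrow> (real \<Rightarrow> real) \<Rightarrow> bool" where
  "diff_times 0 f \<longleftrightarrow> True"
| "diff_times (Suc n) f \<longleftrightarrow> (\<exists>f'. (\<forall>x. (f has_real_derivative f' x) (at x)) \<and> diff_times n f')"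

lemma diff_times_SucI:
  "(\<And>x. (f has_real_derivative f' x) (at x)) \<Longrightarrow> diff_times n f' \<Longrightarrow> diff_times (Suc n) f"
  by auto

lemma diff_times_SucD: "diff_times (Suc n) f \<Longrightarrow> diff_times n f"
proof (induction n arbitrary: f)
  case (Suc n)
  then obtain f' where "\<forall>x. (f has_real_derivative f' x) (at x)" "diff_times (Suc n) f'" by auto
  with Suc.IH[of f'] show ?case by auto
qed simp

lemma diff_times_const: "diff_times n (\<lambda>x. c)"
  by (induction n arbitrary: c) (auto intro!: exI[of _ "\<lambda>x. 0"])

lemma diff_times_add:
  "diff_times n f \<Longrightarrow> diff_times n k \<Longrightarrow> diff_times n (\<lambda>x. f x + k x)"
proof (induction n arbitrary: f k)
  case (Suc n)
  then obtain f' k' where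
    "\<And>x. (f has_real_derivative f' x) (at x)" "diff_times n f'"
    "\<And>x. (k has_real_derivative k' x) (at x)" "diff_times n k'" by auto
  with Suc.IH[of f' k'] show ?case
    by (intro diff_times_SucI[where f' = "\<lambda>x. f' x + k' x"] DERIV_add) auto
qed simp

lemma diff_times_mult:
  "diff_times n f \<Longrightarrow> diff_times n k \<Longrightarrow> diff_times n (\<lambda>x. f x * k x)"
proof (induction n arbitrary: f k)
  case (Suc n)
  then obtain f' k' where
    *: "\<And>x. (f has_real_derivative f' x) (at x)" "diff_times n f'"
    "\<And>x. (k has_real_derivative k' x) (at x)" "diff_times n k'" by auto
  have "diff_times n (\<lambda>x. f' x * k x + k' x * f x)"
    by (intro diff_times_add Suc.IH *(2,4) diff_times_SucD[OF Suc.prems(1)] diff_times_SucD[OF Suc.prems(2)])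
  moreover have "((\<lambda>x. f x * k x) has_real_derivative f' x * k x + k' x * f x) (at x)" for x
    by (rule DERIV_mult[OF *(1) *(3)])
  ultimately show ?case by (rule diff_times_SucI[rotated])
qed simp

lemma diff_times_inverse:
  "diff_times n f \<Longrightarrow> (\<And>x. f x \<noteq> 0) \<Longrightarrow> diff_times n (\<lambda>x. inverse (f x))"
proof (induction n arbitrary: f)
  case (Suc n)
  then obtain f' where
    *: "\<And>x. (f has_real_derivative f' x) (at x)" "diff_times n f'" by auto
  have "diff_times n (\<lambda>x. inverse (f x))"
    using Suc.IH[OF diff_times_SucD] Suc.prems by blast
  then have "diff_times n (\<lambda>x. (- 1) * (f' x * (inverse (f x) * inverse (f x))))"
    using * by (intro diff_times_mult diff_times_const)
  moreover have "((\<lambda>x. inverse (f x)) has_real_derivative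
      (- 1) * (f' x * (inverse (f x) * inverse (f x)))) (at x)" for x
    using DERIV_inverse_fun[OF *(1)[of x]] Suc.prems(2)[of x] by (simp add: power2_eq_square mult_ac)
  ultimately show ?case by (rule diff_times_SucI[rotated])
qed simp

lemma diff_times_reflect: "diff_times n f \<Longrightarrow> diff_times n (\<lambda>x. f (c - x))"
proof (induction n arbitrary: f)
  case (Suc n)
  then obtain f' where
    *: "\<And>x. (f has_real_derivative f' x) (at x)" "diff_times n f'" by auto
  have "diff_times n (\<lambda>x. (- 1) * f' (c - x))"
    using * Suc.IH by (intro diff_times_mult diff_times_const) auto
  moreover have "((\<lambda>x. f (c - x)) has_real_derivative (- 1) * f' (c - x)) (at x)" for x
  proof -
    have "((\<lambda>x. c - x) has_real_derivative - 1) (at x)" by (auto intro!: derivative_eq_intros)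
    from DERIV_chain2[OF *(1)[of "c - x"] this] show ?thesis by (simp only: mult.commute)
  qed
  ultimately show ?case by (rule diff_times_SucI[rotated])
qed simp

text \<open>By uniqueness every witness in \<open>diff_times\<close> is \<open>deriv f\<close>, so
  having derivatives of all orders passes from \<open>f\<close> to \<open>deriv f\<close> and along
  its iterates.\<close>

lemma diff_times_imp_funpow_deriv:
  assumes "\<And>n. diff_times n f"
  shows "((deriv ^^ k) f has_real_derivative (deriv ^^ Suc k) f x) (at x)"
proof -
  have step: "(\<forall>x. (f has_real_derivative deriv f x) (at x)) \<and> (\<forall>n. diff_times n (deriv f))"
    if f: "\<And>n. diff_times n f" for f
  proof -
    have D: "(f has_real_derivative deriv f x) (at x)" for x
      using f[of 1] DERIV_imp_deriv by (metis One_nat_def diff_times.simps(2))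
    moreover have "diff_times n (deriv f)" for n
    proof -
      obtain f' where "\<forall>x. (f has_real_derivative f' x) (at x)" "diff_times n f'"
        using f[of "Suc n"] by auto
      moreover from this have "f' = deriv f" using DERIV_imp_deriv by (metis ext)
      ultimately show ?thesis by simp
    qed
    ultimately show ?thesis by blast
  qed
  have "\<forall>n. diff_times n ((deriv ^^ k) f)"
    by (induction k) (use assms step in auto)
  then show ?thesis using step[of "(deriv ^^ k) f"] by auto
qed

section \<open>The flat exponential and the smooth step built from it\<close>

text \<open>The power in the denominator makes the linear span of the family closed under
  differentiation, so one induction for all \<open>k\<close> at once gives smoothness of exp (-1/x)
  extended by 0.\<close>

definition exp_flat :: "nat \<Rightarrow> real \<Rightarrow> real" where
  "exp_flat k x = (if x > 0 then exp (- (1 / x)) / x ^ k else 0)"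

lemma exp_flat_tendsto_0: "(exp_flat k \<longlongrightarrow> 0) (at_right 0)"
proof -
  have "((\<lambda>y::real. y ^ k / exp y) \<longlongrightarrow> 0) at_top" by (rule tendsto_power_div_exp_0)
  then have "((\<lambda>x::real. (inverse x) ^ k / exp (inverse x)) \<longlongrightarrow> 0) (at_right 0)"
    by (rule filterlim_compose) (rule filterlim_inverse_at_top_right)
  moreover have "eventually (\<lambda>x. (inverse x) ^ k / exp (inverse x) = exp_flat k x) (at_right 0)"
    unfolding eventually_at_right_field
    by (intro exI[of _ 1]) (auto simp: exp_flat_def exp_minus field_simps)
  ultimately show ?thesis by (rule Lim_transform_eventually)
qed

lemma exp_flat_deriv:
  "(exp_flat k has_real_derivative (- real k) * exp_flat (k + 1) x + exp_flat (k + 2) x) (at x)"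
proof -
  consider "x > 0" | "x < 0" | "x = 0" by linarith
  then show ?thesis
  proof cases
    case 1
    have "((\<lambda>x. x ^ k) has_real_derivative real k * x ^ k / x) (at x)"
      using 1 DERIV_pow[of k x] by (cases k) auto
    moreover have "((\<lambda>x. exp (- (1 / x))) has_real_derivative exp (- (1 / x)) / x ^ 2) (at x)"
      using 1 by (auto intro!: derivative_eq_intros simp: power2_eq_square)
    ultimately have D: "((\<lambda>x. exp (- (1 / x)) / x ^ k) has_real_derivative
        (exp (- (1 / x)) / x ^ 2 * x ^ k - exp (- (1 / x)) * (real k * x ^ k / x)) / (x ^ k * x ^ k)) (at x)"
      using 1 by (intro DERIV_divide) auto
    have "(e / x ^ 2 * p - e * (real k * p / x)) / (p * p) =
        (- real k) * (e / (p * x)) + e / (p * (x * x))" if "p \<noteq> 0" for e p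
      using 1 that by (simp add: field_simps power2_eq_square)
    note eq = this[of "x ^ k" "exp (- (1 / x))"]
    have "exp_flat (k + 1) x = exp (- (1 / x)) / (x ^ k * x)"
        "exp_flat (k + 2) x = exp (- (1 / x)) / (x ^ k * (x * x))"
      using 1 by (simp_all add: exp_flat_def power_add power2_eq_square)
    with D eq 1 have "((\<lambda>x. exp (- (1 / x)) / x ^ k) has_real_derivative
        (- real k) * exp_flat (k + 1) x + exp_flat (k + 2) x) (at x)"
      by (simp only:) simp
    then show ?thesis
      by (rule has_field_derivative_transform_within_open[of _ _ _ "{0<..}"])
        (use 1 in \<open>auto simp: exp_flat_def\<close>)
  next
    case 2
    have "((\<lambda>x. 0) has_real_derivative (- real k) * exp_flat (k + 1) x + exp_flat (k + 2) x) (at x)"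
      using 2 by (simp add: exp_flat_def)
    then show ?thesis
      by (rule has_field_derivative_transform_within_open[of _ _ _ "{..<0}"])
        (use 2 in \<open>auto simp: exp_flat_def\<close>)
  next
    case 3
    \<comment> \<open>To the right of 0 the difference quotient is
      \<open>exp_flat (Suc k) y\<close>; to the left it is 0.\<close>
    have "((\<lambda>y. (exp_flat k y - exp_flat k 0) / (y - 0)) \<longlongrightarrow> 0) (at_right 0)"
    proof (rule Lim_transform_eventually[OF exp_flat_tendsto_0[of "Suc k"]])
      show "eventually (\<lambda>y. exp_flat (Suc k) y = (exp_flat k y - exp_flat k 0) / (y - 0)) (at_right 0)"
        unfolding eventually_at_right_field
        by (intro exI[of _ 1]) (auto simp: exp_flat_def field_simps)
    qed
    moreover have "((\<lambda>y. (exp_flat k y - exp_flat k 0) / (y - 0)) \<longlongrightarrow> 0) (at_left 0)"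
    proof (rule Lim_transform_eventually[OF tendsto_const])
      show "eventually (\<lambda>y. 0 = (exp_flat k y - exp_flat k 0) / (y - 0)) (at_left 0)"
        unfolding eventually_at_left_field
        by (intro exI[of _ "-1"]) (auto simp: exp_flat_def)
    qed
    ultimately have "((\<lambda>y. (exp_flat k y - exp_flat k 0) / (y - 0)) \<longlongrightarrow> 0) (at 0)"
      by (simp only: filterlim_at_split)
    then show ?thesis
      using 3 by (simp add: has_field_derivative_iff exp_flat_def)
  qed
qed

lemma diff_times_exp_flat: "diff_times n (exp_flat k)"
proof (induction n arbitrary: k)
  case (Suc n)
  have "diff_times n (\<lambda>x. (- real k) * exp_flat (k + 1) x + exp_flat (k + 2) x)"
    by (intro diff_times_add diff_times_mult diff_times_const Suc.IH)
  then show ?case by (rule diff_times_SucI[OF exp_flat_deriv])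
qed simp

text \<open>The standard quotient f(x) / (f(x) + f(1 - x)); its denominator never vanishes because x
  or 1 - x is positive.\<close>

definition smooth_step :: "real \<Rightarrow> real" where
  "smooth_step x = exp_flat 0 x * inverse (exp_flat 0 x + exp_flat 0 (1 - x))"

lemma exp_flat_sum_pos: "exp_flat 0 x + exp_flat 0 (1 - x) > 0"
  by (auto simp: exp_flat_def add_pos_pos)

lemma diff_times_smooth_step: "diff_times n smooth_step"
  unfolding smooth_step_def[abs_def]
  by (intro diff_times_mult diff_times_inverse diff_times_add diff_times_reflect diff_times_exp_flat)
    (use exp_flat_sum_pos in \<open>simp add: less_imp_neq[symmetric]\<close>)

lemma smooth_step_nonneg: "0 \<le> smooth_step x"
  by (auto simp: smooth_step_def exp_flat_def add_nonneg_nonneg)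

lemma smooth_step_le_1: "smooth_step x \<le> 1"
  using exp_flat_sum_pos[of x]
  by (auto simp: smooth_step_def field_simps) (simp add: exp_flat_def)

lemma smooth_step_eq_0: "x \<le> 0 \<Longrightarrow> smooth_step x = 0"
  by (simp add: smooth_step_def exp_flat_def)

lemma smooth_step_eq_1: "x \<ge> 1 \<Longrightarrow> smooth_step x = 1"
  by (simp add: smooth_step_def exp_flat_def)

lemma smooth_step_deriv:
  "((deriv ^^ k) smooth_step has_real_derivative (deriv ^^ Suc k) smooth_step x) (at x)"
  by (rule diff_times_imp_funpow_deriv[OF diff_times_smooth_step])

text \<open>The derivative within \<open>{..x}\<close> already determines \<open>l\<close>. This
  includes the endpoint x = b, to the right of which \<open>f\<close> may vary.\<close>

lemma DERIV_locally_constant_left: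
  fixes f :: "real \<Rightarrow> real"
  assumes "(f has_real_derivative l) (at x)" and "x \<le> b" and "\<And>y. y \<le> b \<Longrightarrow> f y = c"
  shows "l = 0"
proof -
  have "(f has_real_derivative l) (at x within {..x})"
    using assms(1) by (rule has_field_derivative_at_within)
  then have "((\<lambda>_. c) has_real_derivative l) (at x within {..x})"
    by (rule has_field_derivative_transform_within[of _ _ _ _ 1]) (use assms in auto)
  moreover have "((\<lambda>_. c) has_real_derivative 0) (at x within {..x})" by simp
  moreover have "at x within {..x} \<noteq> bot"
    using at_within_Iic_at_left[of x] by (simp add: trivial_limit_at_left_real)
  ultimately show ?thesis
    by (rule has_field_derivative_unique)
qed

lemma DERIV_locally_constant_right:
  fixes f :: "real \<Rightarrow> real"
  assumes "(f has_real_derivative l) (at x)" and "b \<le> x" and "\<And>y. b \<le> y \<Longrightarrow> f y = c"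
  shows "l = 0"
proof -
  have "((\<lambda>y. f (- y)) has_real_derivative - l) (at (- x))"
    using assms(1) DERIV_mirror by fastforce
  then show ?thesis
    using DERIV_locally_constant_left[of "\<lambda>y. f (- y)" "- l" "- x" "- b" c] assms by auto
qed

text \<open>Induction on the order: the previous derivative is constant on each closed half-line,
  and the one-sided lemmas carry this over, endpoints included.\<close>

lemma smooth_step_deriv_eq_0:
  assumes "k > 0" and "x \<le> 0 \<or> x \<ge> 1"
  shows "(deriv ^^ k) smooth_step x = 0"
  using assms
proof (induction k arbitrary: x)
  case (Suc k)
  show ?case
  proof (cases "x \<le> 0")
    case True
    have "(deriv ^^ k) smooth_step y = 0" if "y \<le> 0" for y
      using Suc.IH[of y] that by (cases k) (auto simp: smooth_step_eq_0)
    then show ?thesis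
      using DERIV_locally_constant_left[OF smooth_step_deriv True] by blast
  next
    case False
    with Suc have "1 \<le> x" by auto
    moreover have "(deriv ^^ k) smooth_step y = of_bool (k = 0)" if "1 \<le> y" for y
      using Suc.IH[of y] that by (cases k) (auto simp: smooth_step_eq_1)
    ultimately show ?thesis
      using DERIV_locally_constant_right[OF smooth_step_deriv] by blast
  qed
qed simp

lemma smooth_step_deriv_left: "x \<le> 0 \<Longrightarrow> (deriv ^^ k) smooth_step x = 0"
  using smooth_step_deriv_eq_0[of k x] by (cases "k = 0") (auto simp: smooth_step_eq_0)

lemma smooth_step_deriv_right: "x \<ge> 1 \<Longrightarrow> (deriv ^^ k) smooth_step x = of_bool (k = 0)"
  using smooth_step_deriv_eq_0[of k x] by (cases "k = 0") (auto simp: smooth_step_eq_1)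

lemma smooth_step_deriv_bounded: "\<exists>M. \<forall>x. \<bar>(deriv ^^ k) smooth_step x\<bar> \<le> M"
proof (cases "k = 0")
  case True
  then show ?thesis
    by (intro exI[of _ 1]) (use smooth_step_nonneg smooth_step_le_1 in auto)
next
  case False
  have "continuous_on {0..1} ((deriv ^^ k) smooth_step)"
    by (intro continuous_at_imp_continuous_on ballI DERIV_isCont[OF smooth_step_deriv])
  then have "bounded ((deriv ^^ k) smooth_step ` {0..1})"
    by (intro compact_imp_bounded compact_continuous_image) auto
  then obtain M where M: "M > 0" "\<And>x. x \<in> {0..1} \<Longrightarrow> \<bar>(deriv ^^ k) smooth_step x\<bar> \<le> M"
    by (auto simp: bounded_pos)
  have "\<bar>(deriv ^^ k) smooth_step x\<bar> \<le> M" for x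
    using M smooth_step_deriv_eq_0[of k x] False by (cases "x \<in> {0..1}") auto
  then show ?thesis by blast
qed

section \<open>Plateau functions on the line\<close>

text \<open>
  \<open>plateau a b k\<close> is the \<open>k\<close>-th derivative of a smooth function that is 1 on \<open>[-a, a]\<close> and
  vanishes outside \<open>[-b, b]\<close>.
\<close>

definition plateau :: "real \<Rightarrow> real \<Rightarrow> nat \<Rightarrow> real \<Rightarrow> real" where
  "plateau a b k x = (- 1 / (b - a)) ^ k *
     ((deriv ^^ k) smooth_step ((b - x) / (b - a)) - (deriv ^^ k) smooth_step ((- a - x) / (b - a)))"

lemma plateau_deriv:
  assumes "a < b"
  shows "(plateau a b k has_real_derivative plateau a b (Suc k) x) (at x)"
proof -
  have *: "((\<lambda>x. (deriv ^^ k) smooth_step ((c - x) / (b - a))) has_real_derivative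
      (- 1 / (b - a)) * (deriv ^^ Suc k) smooth_step ((c - x) / (b - a))) (at x)" for c
  proof -
    have "((\<lambda>x. (c - x) / (b - a)) has_real_derivative - 1 / (b - a)) (at x)"
      by (rule DERIV_cdivide) (auto intro!: derivative_eq_intros)
    from DERIV_chain2[OF smooth_step_deriv this] show ?thesis
      by (simp add: mult.commute)
  qed
  show ?thesis
    unfolding plateau_def[abs_def]
    using DERIV_cmult[OF DERIV_diff[OF *[of b] *[of "- a"]], of "(- 1 / (b - a)) ^ k"]
    by (simp only: power_Suc2 mult.assoc right_diff_distrib)
qed

lemma plateau_outside:
  assumes "0 < a" "a < b" "b \<le> \<bar>x\<bar>"
  shows "plateau a b k x = 0"
proof -
  \<comment> \<open>Beyond \<open>b\<close> both steps are evaluated on the same side of their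
    transition, so they cancel at every order.\<close>
  consider "(b - x) / (b - a) \<le> 0" "(- a - x) / (b - a) \<le> 0"
    | "(b - x) / (b - a) \<ge> 1" "(- a - x) / (b - a) \<ge> 1"
    using assms by (cases "x \<ge> 0") (auto simp: field_simps)
  then have "(deriv ^^ k) smooth_step ((b - x) / (b - a)) = (deriv ^^ k) smooth_step ((- a - x) / (b - a))"
    by cases (simp_all only: smooth_step_deriv_left smooth_step_deriv_right)
  then show ?thesis by (simp add: plateau_def)
qed

lemma plateau_inside:
  assumes "0 < a" "a < b" "\<bar>x\<bar> \<le> a"
  shows "plateau a b k x = of_bool (k = 0)"
proof -
  have "(b - x) / (b - a) \<ge> 1" "(- a - x) / (b - a) \<le> 0"
    using assms by (auto simp: field_simps)
  then show ?thesis
    by (cases "k = 0")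
      (simp_all add: plateau_def smooth_step_deriv_left smooth_step_deriv_right
        smooth_step_eq_0 smooth_step_eq_1)
qed

lemma plateau_0_bounds:
  assumes "0 < a" "a < b"
  shows "0 \<le> plateau a b 0 x" "plateau a b 0 x \<le> 1"
proof -
  \<comment> \<open>The arguments differ by at least 1, so the first step has reached 1 or the
    second is still 0; either way the difference is nonnegative.\<close>
  have "(b - x) / (b - a) - (- a - x) / (b - a) = (a + b) / (b - a)"
    by (simp add: diff_divide_distrib add_divide_distrib)
  also have "\<dots> \<ge> 1" using assms by simp
  finally have "(b - x) / (b - a) - (- a - x) / (b - a) \<ge> 1" .
  then have "(b - x) / (b - a) \<ge> 1 \<or> (- a - x) / (b - a) \<le> 0" by linarith
  then show "0 \<le> plateau a b 0 x"
    using smooth_step_le_1 smooth_step_nonneg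
    by (auto simp: plateau_def smooth_step_eq_0 smooth_step_eq_1)
  show "plateau a b 0 x \<le> 1"
    using smooth_step_le_1[of "(b - x) / (b - a)"] smooth_step_nonneg[of "(- a - x) / (b - a)"]
    by (simp add: plateau_def)
qed

text \<open>Each differentiation costs a factor 1 / (b - a) by the chain rule; what remains is
  bounded independently of \<open>a\<close> and \<open>b\<close>. Summing the bounds over the orders
  gives one \<open>M\<close> for all of them.\<close>

lemma plateau_bound:
  "\<exists>M\<ge>1. \<forall>k\<le>m. \<forall>a b x. a < b \<longrightarrow> \<bar>plateau a b k x\<bar> \<le> M / (b - a) ^ k"
proof -
  obtain N where N: "\<And>k x. \<bar>(deriv ^^ k) smooth_step x\<bar> \<le> N k"
    using smooth_step_deriv_bounded by metis
  have N0: "0 \<le> N k" for k using N[of k 0] by linarith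
  define M where "M = 1 + (\<Sum>k\<le>m. 2 * N k)"
  have "\<bar>plateau a b k x\<bar> \<le> M / (b - a) ^ k" if "k \<le> m" "a < b" for k a b x
  proof -
    have "2 * N k \<le> (\<Sum>k\<le>m. 2 * N k)"
      by (rule member_le_sum) (use that N0 in auto)
    then have "2 * N k \<le> M" by (simp add: M_def)
    moreover have "\<bar>(deriv ^^ k) smooth_step ((b - x) / (b - a)) - (deriv ^^ k) smooth_step ((- a - x) / (b - a))\<bar> \<le> 2 * N k"
      using N[of k "(b - x) / (b - a)"] N[of k "(- a - x) / (b - a)"] by linarith
    ultimately show ?thesis
      using that unfolding plateau_def
      by (simp add: abs_mult power_abs power_divide divide_right_mono)
  qed
  moreover have "M \<ge> 1" unfolding M_def using N0 by (simp add: sum_nonneg)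
  ultimately show ?thesis by blast
qed

section \<open>Partial derivatives of products of one-variable functions\<close>

text \<open>\<open>H k\<close> plays the k-th derivative of a one-variable function and
  \<open>c i\<close> the order in coordinate \<open>i\<close>; along direction \<open>j\<close> only
  one factor varies.\<close>

lemma tensor_partial_deriv:
  fixes H :: "nat \<Rightarrow> real \<Rightarrow> real" and x :: "real^'n"
  assumes H: "\<And>k x. (H k has_real_derivative H (Suc k) x) (at x)"
  shows "((\<lambda>t. \<Prod>i\<in>UNIV. H (c i) ((x + t *\<^sub>R axis j 1) $ i)) has_real_derivative
           (\<Prod>i\<in>UNIV. H (if i = j then Suc (c i) else c i) (x $ i))) (at 0)"
proof -
  have split: "(\<Prod>i\<in>UNIV. F i) = F j * (\<Prod>i\<in>UNIV - {j}. F i)" for F :: "'n \<Rightarrow> real"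
    by (rule prod.remove) auto
  have "((\<lambda>t. x $ j + t) has_real_derivative 1) (at 0)"
    by (auto intro!: derivative_eq_intros)
  then have "((\<lambda>t. H (c j) (x $ j + t)) has_real_derivative H (Suc (c j)) (x $ j) * 1) (at 0)"
    by (rule DERIV_chain2[rotated]) (use H[of "c j" "x $ j"] in simp)
  then have "((\<lambda>t. H (c j) (x $ j + t) * (\<Prod>i\<in>UNIV - {j}. H (c i) (x $ i))) has_real_derivative
     H (Suc (c j)) (x $ j) * (\<Prod>i\<in>UNIV - {j}. H (c i) (x $ i))) (at 0)"
    using DERIV_cmult_right by fastforce
  moreover have "(\<Prod>i\<in>UNIV. H (c i) ((x + t *\<^sub>R axis j 1) $ i)) =
      H (c j) (x $ j + t) * (\<Prod>i\<in>UNIV - {j}. H (c i) (x $ i))" for t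
    unfolding split by (auto simp: axis_def intro!: prod.cong)
  moreover have "(\<Prod>i\<in>UNIV. H (if i = j then Suc (c i) else c i) (x $ i)) =
      H (Suc (c j)) (x $ j) * (\<Prod>i\<in>UNIV - {j}. H (c i) (x $ i))"
    unfolding split by (auto intro!: prod.cong)
  ultimately show ?thesis by simp
qed

text \<open>Only the number of occurrences of each index survives, so the arbitrary ordering chosen
  in \<open>mi_deriv\<close> has no effect on products.\<close>

lemma iter_partial_tensor:
  fixes H :: "nat \<Rightarrow> real \<Rightarrow> real"
  assumes H: "\<And>k x. (H k has_real_derivative H (Suc k) x) (at x)"
  shows "iter_partial is (\<lambda>x::real^'n. \<Prod>i\<in>UNIV. H 0 (x $ i)) = (\<lambda>x. \<Prod>i\<in>UNIV. H (count_list is i) (x $ i))"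
proof (induction "is")
  case Nil
  then show ?case by (simp add: iter_partial_def)
next
  case (Cons j js)
  have "iter_partial (j # js) (\<lambda>x::real^'n. \<Prod>i\<in>UNIV. H 0 (x $ i)) =
      partial_deriv j (\<lambda>x. \<Prod>i\<in>UNIV. H (count_list js i) (x $ i))"
    using Cons by (simp add: iter_partial_def)
  also have "\<dots> = (\<lambda>x. \<Prod>i\<in>UNIV. H (count_list (j # js) i) (x $ i))"
    unfolding partial_deriv_def
    by (rule ext, rule trans[OF DERIV_imp_deriv[OF tensor_partial_deriv[of H, OF H]]]) (auto intro!: prod.cong)
  finally show ?case .
qed

lemma smooth_tensor:
  fixes H :: "nat \<Rightarrow> real \<Rightarrow> real"
  assumes H: "\<And>k x. (H k has_real_derivative H (Suc k) x) (at x)"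
  shows "smooth (\<lambda>x::real^'n. \<Prod>i\<in>UNIV. H 0 (x $ i))"
proof -
  have "continuous_on UNIV (\<lambda>x::real^'n. \<Prod>i\<in>UNIV. H (c i) (x $ i))" for c :: "'n \<Rightarrow> nat"
  proof (intro continuous_on_prod)
    fix i
    have "continuous_on UNIV (H (c i))"
      by (intro continuous_at_imp_continuous_on ballI DERIV_isCont[OF H])
    then show "continuous_on UNIV (\<lambda>x::real^'n. H (c i) (x $ i))"
      by (rule continuous_on_compose2) (auto intro!: continuous_intros)
  qed
  then show ?thesis
    unfolding smooth_def iter_partial_tensor[of H, OF H]
    using tensor_partial_deriv[of H, OF H] unfolding field_differentiable_def by blast
qed

text \<open>Guarantees that the choice made in \<open>mi_deriv\<close> has a list to choose.\<close>

lemma ex_count_list_eq: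
  fixes c :: "'n::finite \<Rightarrow> nat"
  shows "\<exists>xs. \<forall>i. count_list xs i = c i"
proof -
  have count_replicate: "count_list (replicate k x) y = (if x = y then k else 0)" for k and x y :: 'n
    by (induction k) auto
  have "\<exists>xs. \<forall>i. count_list xs i = (if i \<in> S then c i else 0)" if "finite S" for S
    using that
  proof induction
    case (insert j S)
    then obtain xs where "\<forall>i. count_list xs i = (if i \<in> S then c i else 0)" by blast
    with insert show ?case
      by (intro exI[of _ "replicate (c j) j @ xs"]) (auto simp: count_replicate)
  qed (auto intro: exI[of _ "[]"])
  from this[of UNIV] show ?thesis by simp
qed

lemma mi_deriv_tensor:
  fixes H :: "nat \<Rightarrow> real \<Rightarrow> real"
  assumes H: "\<And>k x. (H k has_real_derivative H (Suc k) x) (at x)"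
  shows "mi_deriv \<alpha> (\<lambda>x::real^'n. \<Prod>i\<in>UNIV. H 0 (x $ i)) = (\<lambda>x. \<Prod>i\<in>UNIV. H (\<alpha> i) (x $ i))"
  unfolding mi_deriv_def iter_partial_tensor[of H, OF H]
  using someI_ex[OF ex_count_list_eq[of \<alpha>]] by simp

text \<open>Each entry is at most \<open>m\<close>. Finiteness makes the sum over multi-indices a
  genuine one and allows their null sets to be joined.\<close>

lemma finite_multi_indices: "finite {\<alpha> :: 'n::finite \<Rightarrow> nat. mi_size \<alpha> = m}"
proof (rule finite_subset)
  show "{\<alpha> :: 'n \<Rightarrow> nat. mi_size \<alpha> = m} \<subseteq> UNIV \<rightarrow>\<^sub>E {..m}"
  proof (intro subsetI PiE_I)
    fix \<alpha> :: "'n \<Rightarrow> nat" and i assume "\<alpha> \<in> {\<alpha>. mi_size \<alpha> = m}"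
    then show "\<alpha> i \<in> {..m}" 
      using member_le_sum[of i UNIV \<alpha>] by (auto simp: mi_size_def)
  qed auto
  show "finite ((UNIV :: 'n set) \<rightarrow>\<^sub>E {..m})" by (intro finite_PiE) auto
qed

section \<open>Cubes and the cutoffs between them\<close>

text \<open>Balls of the maximum norm fit cutoffs that are products over the coordinates.\<close>

definition cube :: "real \<Rightarrow> (real ^ 'n::finite) set" where
  "cube r = {x. \<forall>i. \<bar>x $ i\<bar> \<le> r}"

lemma cube_eq_cbox: "cube r = cbox (\<chi> i. - r) (\<chi> i. r)"
  by (auto simp: cube_def mem_box_cart abs_le_iff minus_le_iff)

lemma compact_cube: "compact (cube r)"
  by (simp add: cube_eq_cbox)

lemma lmeasurable_cube: "cube r \<in> lmeasurable"
  by (simp add: cube_eq_cbox)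

lemma cube_mono: "a \<le> b \<Longrightarrow> cube a \<subseteq> cube b"
  by (auto simp: cube_def intro: order_trans)

lemma measure_cube:
  assumes "r \<ge> 0"
  shows "measure lebesgue (cube r :: (real ^ 'n::finite) set) = (2 * r) ^ CARD('n)"
proof -
  have "cbox (\<chi> i. - r) (\<chi> i. r) \<noteq> ({} :: (real ^ 'n) set)"
    using assms by (auto simp: interval_ne_empty_cart)
  from content_cbox_cart[OF this] show ?thesis
    by (simp add: cube_eq_cbox measure_completion)
qed

definition cutoff :: "real \<Rightarrow> real \<Rightarrow> real ^ 'n::finite \<Rightarrow> real" where
  "cutoff a b x = (\<Prod>i\<in>UNIV. plateau a b 0 (x $ i))"

text \<open>Collects what testing the inequality uses. In the last bound the coordinate estimates
  multiply, and their exponents add up to \<open>mi_size \<alpha>\<close>.\<close>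

lemma cutoff_function:
  fixes a b :: real and x :: "real ^ 'n"
  assumes ab: "0 < a" "a < b"
  shows "test_function (cutoff a b :: real ^ 'n \<Rightarrow> real)"
    "0 \<le> cutoff a b x" "cutoff a b x \<le> 1"
    "x \<in> cube a \<Longrightarrow> cutoff a b x = 1"
    "x \<notin> cube b \<Longrightarrow> cutoff a b x = 0"
    "continuous_on UNIV (cutoff a b :: real ^ 'n \<Rightarrow> real)"
    "\<And>\<alpha>. x \<notin> cube b \<Longrightarrow> mi_deriv \<alpha> (cutoff a b) x = 0"
    "\<And>\<alpha>. mi_size \<alpha> \<ge> 1 \<Longrightarrow> x \<in> cube a \<Longrightarrow> mi_deriv \<alpha> (cutoff a b) x = 0"
    "\<And>\<alpha> M. (\<And>k y. k \<le> mi_size \<alpha> \<Longrightarrow> \<bar>plateau a b k y\<bar> \<le> M / (b - a) ^ k) \<Longrightarrow>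
       \<bar>mi_deriv \<alpha> (cutoff a b) x\<bar> \<le> M ^ CARD('n) / (b - a) ^ mi_size \<alpha>"
proof -
  note deriv = plateau_deriv[OF ab(2)]
  have mi: "mi_deriv \<alpha> (cutoff a b) = (\<lambda>x::real ^ 'n. \<Prod>i\<in>UNIV. plateau a b (\<alpha> i) (x $ i))" for \<alpha>
    unfolding cutoff_def[abs_def] by (rule mi_deriv_tensor[of "plateau a b", OF deriv])
  have sm: "smooth (cutoff a b :: real ^ 'n \<Rightarrow> real)"
    unfolding cutoff_def[abs_def] by (rule smooth_tensor[of "plateau a b", OF deriv])
  then show "continuous_on UNIV (cutoff a b :: real ^ 'n \<Rightarrow> real)"
    unfolding smooth_def iter_partial_def by (metis foldr.simps(1) id_apply)
  have outside: "\<exists>i. b \<le> \<bar>x $ i\<bar>" if "x \<notin> cube b" for x :: "real^'n"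
    using that by (auto simp: cube_def not_le intro: less_imp_le)
  show out: "mi_deriv \<alpha> (cutoff a b) x = 0" if "x \<notin> cube b" for \<alpha> and x :: "real ^ 'n"
    using outside[OF that] plateau_outside[OF ab] unfolding mi by (auto intro!: prod_zero)
  show phi0: "cutoff a b x = 0" if "x \<notin> cube b" for x :: "real ^ 'n"
    using outside[OF that] plateau_outside[OF ab] unfolding cutoff_def[abs_def] by (auto intro!: prod_zero)
  show "cutoff a b x = 1" if "x \<in> cube a"
    using that plateau_inside[OF ab] unfolding cutoff_def[abs_def] cube_def by (auto intro!: prod.neutral)
  show "0 \<le> cutoff a b x" "cutoff a b x \<le> 1"
    unfolding cutoff_def[abs_def] using plateau_0_bounds[OF ab] by (auto intro!: prod_nonneg prod_le_1)
  have "closure {x :: real ^ 'n. cutoff a b x \<noteq> 0} \<subseteq> cube b"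
    using phi0 by (intro closure_minimal compact_imp_closed compact_cube) auto
  then have "compact (closure {x :: real ^ 'n. cutoff a b x \<noteq> 0})"
    using compact_cube[of b] closed_closure compact_Int_closed[of "cube b" "closure {x :: real ^ 'n. cutoff a b x \<noteq> 0}"]
    by (simp add: Int_absorb1 Int_absorb2)
  with sm show "test_function (cutoff a b :: real ^ 'n \<Rightarrow> real)" by (simp add: test_function_def)
  show "mi_deriv \<alpha> (cutoff a b) x = 0" if "mi_size \<alpha> \<ge> 1" "x \<in> cube a" for \<alpha>
  proof -
    \<comment> \<open>Positive order means that some coordinate is really differentiated, and its
      plateau is constant on [-a, a].\<close>
    have "\<exists>i. \<alpha> i \<noteq> 0" using that(1) by (rule_tac ccontr) (simp add: mi_size_def)
    then obtain i where "\<alpha> i \<noteq> 0" ..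
    then have "plateau a b (\<alpha> i) (x $ i) = 0"
      using plateau_inside[OF ab, of "x $ i" "\<alpha> i"] that by (auto simp: cube_def)
    then show ?thesis unfolding mi by (auto intro!: prod_zero)
  qed
  show "\<bar>mi_deriv \<alpha> (cutoff a b) x\<bar> \<le> M ^ CARD('n) / (b - a) ^ mi_size \<alpha>"
    if M: "\<And>k y. k \<le> mi_size \<alpha> \<Longrightarrow> \<bar>plateau a b k y\<bar> \<le> M / (b - a) ^ k" for \<alpha> M
  proof -
    have "\<bar>mi_deriv \<alpha> (cutoff a b) x\<bar> = (\<Prod>i\<in>UNIV. \<bar>plateau a b (\<alpha> i) (x $ i)\<bar>)"
      unfolding mi by (rule abs_prod)
    also have "\<dots> \<le> (\<Prod>i\<in>UNIV. M / (b - a) ^ \<alpha> i)"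
      using M member_le_sum[of _ UNIV \<alpha>] by (intro prod_mono) (auto simp: mi_size_def)
    also have "\<dots> = M ^ CARD('n) / (b - a) ^ mi_size \<alpha>"
      by (simp add: prod_dividef mi_size_def power_sum)
    finally show ?thesis .
  qed
qed

section \<open>The integral inequalities\<close>

text \<open>A supporting line of \<open>g\<close> at \<open>t\<close> is integrated over
  \<open>S\<close>. Its slope is nonnegative because \<open>g\<close> is nondecreasing, so
  \<open>t\<close> may be any positive lower bound of the mean of |u|.\<close>

lemma convex_integral_lower_bound:
  fixes g :: "real \<Rightarrow> real" and u :: "'a::euclidean_space \<Rightarrow> real"
  assumes g: "convex_on {0..} g" "mono_on {0..} g"
    and S: "S \<in> lmeasurable"
    and u: "set_integrable lebesgue S u" and gu: "set_integrable lebesgue S (\<lambda>x. g \<bar>u x\<bar>)"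
    and t: "t > 0" "t * measure lebesgue S \<le> (LINT x:S|lebesgue. \<bar>u x\<bar>)"
  shows "measure lebesgue S * g t \<le> (LINT x:S|lebesgue. g \<bar>u x\<bar>)"
proof -
  \<comment> \<open>The infimum of the secant slopes to the right of \<open>t\<close>, that is the
    right derivative, is the slope of a supporting line.\<close>
  define D where "D = (\<lambda>y. (g t - g y) / (t - y)) ` ({t<..} \<inter> {0..})"
  define s where "s = Inf D"
  have ui: "t \<in> interior {0..}" using t by simp
  have support: "g t + s * (y - t) \<le> g y" if "y \<ge> 0" for y
    using convex_le_Inf_differential[OF g(1) ui, of y] that unfolding s_def D_def by simp
  have "s \<ge> 0"
    unfolding s_def
  proof (rule cInf_greatest)
    show "D \<noteq> {}" unfolding D_def using t by (auto simp: ex_in_conv[symmetric] intro!: exI[of _ "t + 1"])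
    fix d assume "d \<in> D"
    then obtain y where y: "y > t" "d = (g t - g y) / (t - y)" unfolding D_def by auto
    moreover have "g t \<le> g y" using g(2) y t by (auto simp: mono_on_def)
    ultimately show "d \<ge> 0" by (simp add: divide_nonpos_neg)
  qed
  have int1: "set_integrable lebesgue S (\<lambda>x. 1 :: real)"
    using S by (simp add: set_integrable_def lmeasurable_iff_integrable)
  have m1: "(LINT x:S|lebesgue. (1::real)) = measure lebesgue S"
    using S by (simp add: set_lebesgue_integral_def fmeasurable_def)
  have int_const: "set_integrable lebesgue S (\<lambda>x. (g t - s * t) * 1)"
    by (intro set_integrable_mult_right int1)
  have int_u: "set_integrable lebesgue S (\<lambda>x. s * \<bar>u x\<bar>)"
    by (intro set_integrable_mult_right set_integrable_abs u)
  note int = set_integral_add(1)[OF int_const int_u]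
  have "measure lebesgue S * g t \<le> (g t - s * t) * measure lebesgue S + s * (LINT x:S|lebesgue. \<bar>u x\<bar>)"
    using mult_left_mono[OF t(2) \<open>s \<ge> 0\<close>] by (simp add: algebra_simps)
  also have "\<dots> = (LINT x:S|lebesgue. (g t - s * t) * 1 + s * \<bar>u x\<bar>)"
    by (simp only: set_integral_add(2)[OF int_const int_u] set_integral_mult_right m1)
  also have "\<dots> \<le> (LINT x:S|lebesgue. g \<bar>u x\<bar>)"
  proof (rule set_integral_mono[OF int gu])
    show "(g t - s * t) * 1 + s * \<bar>u x\<bar> \<le> g \<bar>u x\<bar>" for x
      using support[of "\<bar>u x\<bar>"] by (simp add: algebra_simps)
  qed
  finally show ?thesis .
qed

lemma convex_integral_lower_bound_divide:
  fixes g :: "real \<Rightarrow> real" and u :: "'a::euclidean_space \<Rightarrow> real"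
  assumes g: "convex_on {0..} g" "mono_on {0..} g"
    and S: "S \<in> lmeasurable"
    and u: "set_integrable lebesgue S u" and gu: "set_integrable lebesgue S (\<lambda>x. g \<bar>u x\<bar>)"
    and V: "measure lebesgue S = V" "V > 0" and C: "C > 0"
    and W: "W > 0" "W \<le> C * (LINT x:S|lebesgue. \<bar>u x\<bar>)"
  shows "V * g (W / (C * V)) \<le> (LINT x:S|lebesgue. g \<bar>u x\<bar>)"
proof -
  have "W / (C * V) * measure lebesgue S \<le> (LINT x:S|lebesgue. \<bar>u x\<bar>)"
    using V C W(2) by (simp add: field_simps)
  from convex_integral_lower_bound[OF g S u gu _ this] show ?thesis
    using V C W(1) by simp
qed

text \<open>Only \<open>g 0\<close> is in question. The chord from 0 to 1 lies above the positive
  values of \<open>g\<close> near 0, and it tends to \<open>g 0\<close> there.\<close>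

lemma convex_mono_nonneg:
  fixes g :: "real \<Rightarrow> real"
  assumes g: "convex_on {0..} g" "mono_on {0..} g" "\<And>t. t > 0 \<Longrightarrow> g t > 0" and t: "t \<ge> 0"
  shows "g t \<ge> 0"
proof -
  have "0 \<le> (1 - e) * g 0 + e * g 1" if "0 < e" "e < 1" for e
    using convex_onD[OF g(1), of e 0 1] g(3)[of e] that by simp
  then have "eventually (\<lambda>e. 0 \<le> (1 - e) * g 0 + e * g 1) (at_right 0)"
    unfolding eventually_at_right_field by (intro exI[of _ 1]) auto
  moreover have "((\<lambda>e. (1 - e) * g 0 + e * g 1) \<longlongrightarrow> (1 - 0) * g 0 + 0 * g 1) (at_right 0)"
    by (intro tendsto_intros)
  ultimately have "0 \<le> (1 - 0) * g 0 + 0 * g 1"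
    by (intro tendsto_lowerbound) auto
  then show ?thesis using g(3)[of t] t by (cases "t = 0") auto
qed

section \<open>The weak inequality tested with cutoffs\<close>

text \<open>The cutoff is 1 on the inner cube. As \<open>m\<close> is positive, its derivatives of
  order \<open>m\<close> vanish off the annulus; on it they are of size (R - r)^(-m), and the linear
  bound on the coefficients leaves only |u|.\<close>

lemma weak_solution_annulus_estimate:
  fixes m :: nat and A :: real
    and a :: "('n::finite \<Rightarrow> nat) \<Rightarrow> real ^ 'n \<Rightarrow> real \<Rightarrow> real"
    and g :: "real \<Rightarrow> real" and u :: "real ^ 'n \<Rightarrow> real"
  assumes m: "m \<ge> 1" and A: "A > 0"
    and bound: "\<And>\<alpha>. mi_size \<alpha> = m \<Longrightarrow> (AE x in lebesgue. \<forall>\<zeta>. \<bar>a \<alpha> x \<zeta>\<bar> \<le> A * \<bar>\<zeta>\<bar>)"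
    and g0: "\<And>t. t \<ge> 0 \<Longrightarrow> g t \<ge> 0"
    and sol: "global_weak_solution m a g u"
  obtains C where "C > 0" and "\<And>r R. 0 < r \<Longrightarrow> r < R \<Longrightarrow>
     (R - r) ^ m * (LINT x:cube r|lebesgue. g \<bar>u x\<bar>) \<le> C * (LINT x:cube R - cube r|lebesgue. \<bar>u x\<bar>)"
proof -
  obtain M where M: "M \<ge> 1" "\<And>k r R y. k \<le> m \<Longrightarrow> r < R \<Longrightarrow> \<bar>plateau r R k y\<bar> \<le> M / (R - r) ^ k"
    using plateau_bound[of m] by blast
  define F where "F = {\<alpha> :: 'n \<Rightarrow> nat. mi_size \<alpha> = m}"
  have finF: "finite F" unfolding F_def by (rule finite_multi_indices)
  \<comment> \<open>The number of multi-indices times the bound for one of them; the added 1 makes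
    \<open>C\<close> positive whatever that number is.\<close>
  define C where "C = A * (real (card F) * M ^ CARD('n)) + 1"
  have "C > 0" unfolding C_def using A M(1) by (intro add_nonneg_pos mult_nonneg_nonneg) auto
  have u_int: "set_integrable lebesgue K u" and gu_int: "set_integrable lebesgue K (\<lambda>x. g \<bar>u x\<bar>)"
    if "compact K" for K
    using sol that unfolding global_weak_solution_def L1_loc_def by auto
  have AEF: "AE x in lebesgue. \<forall>\<alpha>\<in>F. \<forall>\<zeta>. \<bar>a \<alpha> x \<zeta>\<bar> \<le> A * \<bar>\<zeta>\<bar>"
    using finF bound by (intro AE_finite_allI) (auto simp: F_def)
  have "(R - r) ^ m * (LINT x:cube r|lebesgue. g \<bar>u x\<bar>) \<le> C * (LINT x:cube R - cube r|lebesgue. \<bar>u x\<bar>)"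
    if r: "0 < r" "r < R" for r R
  proof -
    define \<phi> where "\<phi> = (cutoff r R :: real ^ 'n \<Rightarrow> real)"
    note \<phi> = cutoff_function[OF r, where 'n='n, folded \<phi>_def]
    define L where "L = A * M ^ CARD('n) / (R - r) ^ m"
    have L0: "L \<ge> 0" unfolding L_def using A M(1) r by simp
    define B where "B = (\<lambda>x. real (card F) * L * (indicator (cube R - cube r) x * \<bar>u x\<bar>))"
    have meas: "\<phi> \<in> borel_measurable lebesgue"
      using borel_measurable_continuous_onI[OF \<phi>(6)] by (simp add: measurable_completion)
    have gr: "integrable lebesgue (\<lambda>x. indicator (cube r) x * g \<bar>u x\<bar>)"
      and gR: "integrable lebesgue (\<lambda>x. indicator (cube R) x * g \<bar>u x\<bar>)"
      using gu_int[OF compact_cube] by (auto simp: set_integrable_def)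
    have "integrable lebesgue (\<lambda>x. (indicator (cube R) x * g \<bar>u x\<bar>) * \<phi> x)"
    proof (rule Bochner_Integration.integrable_bound[OF gR])
      show "(\<lambda>x. indicator (cube R) x * g \<bar>u x\<bar> * \<phi> x) \<in> borel_measurable lebesgue"
        by (rule borel_measurable_times[OF borel_measurable_integrable[OF gR] meas])
      show "AE x in lebesgue. norm (indicator (cube R) x * g \<bar>u x\<bar> * \<phi> x) \<le> norm (indicator (cube R) x * g \<bar>u x\<bar>)"
        using \<phi>(2,3) by (intro AE_I2) (auto simp: abs_mult intro!: mult_left_le)
    qed
    moreover have eq: "(indicator (cube R) x * g \<bar>u x\<bar>) * \<phi> x = g \<bar>u x\<bar> * \<phi> x" for x
      using \<phi>(5)[of x] by (auto simp: indicator_def)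
    ultimately have gphi: "integrable lebesgue (\<lambda>x. g \<bar>u x\<bar> * \<phi> x)" by simp
    have annulus: "cube R - cube r \<in> lmeasurable" for r R :: real
      by (intro fmeasurable.Diff lmeasurable_cube)
    have "set_integrable lebesgue (cube R - cube r) u"
      using u_int[OF compact_cube[of R]] by (rule set_integrable_subset) (use annulus in auto)
    then have "integrable lebesgue (\<lambda>x. indicator (cube R - cube r) x * \<bar>u x\<bar>)"
      using set_integrable_abs by (auto simp: set_integrable_def)
    then have Bint: "integrable lebesgue B" unfolding B_def by (rule integrable_mult_right)
    have "(LINT x:cube r|lebesgue. g \<bar>u x\<bar>) \<le> (LINT x|lebesgue. g \<bar>u x\<bar> * \<phi> x)"
      unfolding set_lebesgue_integral_def real_scaleR_def
    proof (rule integral_mono[OF gr gphi])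
      show "indicator (cube r) x * g \<bar>u x\<bar> \<le> g \<bar>u x\<bar> * \<phi> x" for x
        using \<phi>(2)[of x] \<phi>(4)[of x] g0[of "\<bar>u x\<bar>"] by (auto simp: indicator_def)
    qed
    also have "\<dots> \<le> (LINT x|lebesgue. (\<Sum>\<alpha> | mi_size \<alpha> = m. (-1) ^ m * a \<alpha> x (u x) * mi_deriv \<alpha> \<phi> x))"
      using sol \<phi>(1,2) unfolding global_weak_solution_def by auto
    also have "\<dots> \<le> (LINT x|lebesgue. B x)"
    \<comment> \<open>The comparison rests on \<open>B\<close> being integrable and nonnegative; it
      also covers the default value 0 of a non-integrable left side.\<close>
    proof (rule integral_mono_AE'[OF Bint])
      show "AE x in lebesgue. (\<Sum>\<alpha> | mi_size \<alpha> = m. (-1) ^ m * a \<alpha> x (u x) * mi_deriv \<alpha> \<phi> x) \<le> B x"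
        using AEF
      proof eventually_elim
        case (elim x)
        have "(-1) ^ m * a \<alpha> x (u x) * mi_deriv \<alpha> \<phi> x \<le> L * (indicator (cube R - cube r) x * \<bar>u x\<bar>)"
          if \<alpha>: "mi_size \<alpha> = m" for \<alpha>
        proof (cases "x \<in> cube R - cube r")
          case True
          have "(-1) ^ m * a \<alpha> x (u x) * mi_deriv \<alpha> \<phi> x \<le> \<bar>a \<alpha> x (u x)\<bar> * \<bar>mi_deriv \<alpha> \<phi> x\<bar>"
            by (rule order_trans[OF abs_ge_self]) (simp add: abs_mult power_abs)
          also have "\<dots> \<le> (A * \<bar>u x\<bar>) * (M ^ CARD('n) / (R - r) ^ m)"
          proof (rule mult_mono)
            show "\<bar>a \<alpha> x (u x)\<bar> \<le> A * \<bar>u x\<bar>" using elim \<alpha> by (auto simp: F_def)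
            show "\<bar>mi_deriv \<alpha> \<phi> x\<bar> \<le> M ^ CARD('n) / (R - r) ^ m"
              using \<phi>(9)[of \<alpha> M x] M(2) r \<alpha> by auto
          qed (use A in auto)
          finally show ?thesis using True by (simp add: L_def mult_ac)
        next
          case False
          then have "mi_deriv \<alpha> \<phi> x = 0" using \<phi>(7)[of x \<alpha>] \<phi>(8)[of \<alpha> x] \<alpha> m by auto
          then show ?thesis using L0 by simp
        qed
        then have "(\<Sum>\<alpha> | mi_size \<alpha> = m. (-1) ^ m * a \<alpha> x (u x) * mi_deriv \<alpha> \<phi> x) \<le>
            real (card F) * (L * (indicator (cube R - cube r) x * \<bar>u x\<bar>))"
          unfolding F_def by (intro sum_bounded_above) auto
        then show ?case by (simp add: B_def mult_ac)
      qed
      show "AE x in lebesgue. 0 \<le> B x" unfolding B_def using L0 by (intro AE_I2) auto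
    qed
    also have "\<dots> = real (card F) * L * (LINT x:cube R - cube r|lebesgue. \<bar>u x\<bar>)"
      unfolding B_def set_lebesgue_integral_def by simp
    finally have "(R - r) ^ m * (LINT x:cube r|lebesgue. g \<bar>u x\<bar>) \<le>
        (R - r) ^ m * (real (card F) * L * (LINT x:cube R - cube r|lebesgue. \<bar>u x\<bar>))"
      using r by (intro mult_left_mono) auto
    also have "\<dots> = (C - 1) * (LINT x:cube R - cube r|lebesgue. \<bar>u x\<bar>)"
      using r by (simp add: L_def C_def field_simps)
    also have "\<dots> \<le> C * (LINT x:cube R - cube r|lebesgue. \<bar>u x\<bar>)"
      by (intro mult_right_mono) (auto simp: set_lebesgue_integral_def)
    finally show ?thesis .
  qed
  with \<open>C > 0\<close> show ?thesis using that by blast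
qed

section \<open>Growth of sequences and functions under the integral conditions\<close>

text \<open>The left side is a lower rectangle for the integral of z powr (-1 - q) from
  \<open>x\<close> to \<open>y\<close>; the mean value theorem takes the place of
  integration.\<close>

lemma powr_telescope:
  fixes x y q :: real
  assumes "0 < x" "x \<le> y" "q > 0"
  shows "(y - x) * y powr (- 1 - q) \<le> (x powr - q - y powr - q) / q"
proof (cases "x = y")
  case False
  with assms have "x < y" by simp
  have "\<exists>z. x < z \<and> z < y \<and> y powr - q - x powr - q = (y - x) * (- q * z powr (- q - 1))"
    using assms \<open>x < y\<close> by (intro MVT2) (auto intro!: derivative_eq_intros simp: powr_diff)
  then obtain z where z: "x < z" "z < y" "y powr - q - x powr - q = (y - x) * (- q * z powr (- q - 1))"
    by blast
  have "y powr (- 1 - q) \<le> z powr (- q - 1)"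
    using z assms powr_mono2'[of "- 1 - q" z y] by (simp add: minus_diff_commute add.commute)
  then have "(y - x) * y powr (- 1 - q) \<le> (y - x) * z powr (- q - 1)"
    using \<open>x < y\<close> by (intro mult_left_mono) auto
  also have "\<dots> = (x powr - q - y powr - q) / q"
    using z(3) assms by (simp add: field_simps)
  finally show ?thesis .
qed simp

section \<open>The integral condition at infinity\<close>

text \<open>The integrand is nonincreasing, so its integral over (2^k, 2^(k+1)] is at least 2^k
  times its value at the right end, which is half the term of index k + 1.\<close>

lemma summable_dyadic:
  fixes g :: "real \<Rightarrow> real"
  assumes m: "m \<ge> 1" and g: "mono_on {0..} g" "\<And>t. t > 0 \<Longrightarrow> g t > 0"
    and fin: "(\<integral>\<^sup>+ \<zeta> \<in> {1..}. ennreal (g \<zeta> powr (- 1 / real m) * \<zeta> powr (1 / real m - 1)) \<partial>lborel) < \<infinity>"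
  shows "summable (\<lambda>k. (2 ^ k / g (2 ^ k)) powr (1 / real m))"
proof -
  define f where "f = (\<lambda>\<zeta>. g \<zeta> powr (- 1 / real m) * \<zeta> powr (1 / real m - 1))"
  \<comment> \<open>Monotonicity holds on a half-line only; the indicator yields a function that is
    Borel measurable on the whole line.\<close>
  have gm: "(\<lambda>x. indicator {1..} x * g x) \<in> borel_measurable borel"
  proof -
    have "g \<in> borel_measurable (restrict_space borel {1..})"
      by (rule borel_measurable_mono_on_fnc) (rule mono_on_subset[OF g(1)], auto)
    then show ?thesis by (subst (asm) borel_measurable_restrict_space_iff) auto
  qed
  define h where "h = (\<lambda>x. ennreal ((indicator {1..} x * g x) powr (- 1 / real m) * x powr (1 / real m - 1)) * indicator {1..} x)"
  have h: "h \<in> borel_measurable borel" unfolding h_def using gm by measurable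
  have h_eq: "h = (\<lambda>x. ennreal (f x) * indicator {1..} x)"
    by (auto simp: h_def f_def indicator_def)
  define a where "a = (\<lambda>k::nat. (2 ^ k / g (2 ^ k)) powr (1 / real m))"
  \<comment> \<open>With integrals written as values of a measure, the dyadic pieces combine by
    additivity.\<close>
  define N where "N = density lborel h"
  have N: "emeasure N S = (\<integral>\<^sup>+ x. h x * indicator S x \<partial>lborel)" if "S \<in> sets borel" for S
    using that h by (simp add: N_def emeasure_density)
  have a0: "a k \<ge> 0" for k by (simp add: a_def)
  have step: "ennreal (a (Suc k) / 2) \<le> emeasure N {2 ^ k<..2 ^ Suc k}" for k :: nat
  proof -
    let ?p = "(2::real) ^ Suc k"
    have p: "?p > 0" "g ?p > 0" using g(2) by auto
    have "a (Suc k) / 2 = (g ?p powr (- 1 / real m) * ?p powr (1 / real m - 1)) * 2 ^ k"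
    proof -
      have "?p powr (1 / real m - 1) = ?p powr (1 / real m) / ?p"
        using p by (simp add: powr_diff)
      moreover have "g ?p powr (- 1 / real m) = 1 / g ?p powr (1 / real m)"
        by (simp add: powr_minus_divide)
      ultimately show ?thesis using p by (simp add: a_def powr_divide)
    qed
    then have "ennreal (a (Suc k) / 2) = ennreal (g ?p powr (- 1 / real m) * ?p powr (1 / real m - 1)) * emeasure lborel {2 ^ k<..?p}"
      by (simp add: ennreal_mult'' ennreal_mult)
    also have "\<dots> = (\<integral>\<^sup>+ x. ennreal (g ?p powr (- 1 / real m) * ?p powr (1 / real m - 1)) * indicator {2 ^ k<..?p} x \<partial>lborel)"
      by (simp add: nn_integral_cmult_indicator)
    also have "\<dots> \<le> (\<integral>\<^sup>+ x. h x * indicator {2 ^ k<..?p} x \<partial>lborel)"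
    proof (rule nn_integral_mono)
      fix x :: real
      show "ennreal (g ?p powr (- 1 / real m) * ?p powr (1 / real m - 1)) * indicator {2 ^ k<..?p} x \<le> h x * indicator {2 ^ k<..?p} x"
      proof (cases "x \<in> {2 ^ k<..?p}")
        case True
        have "(1::real) \<le> 2 ^ k" by simp
        moreover have "2 ^ k < x" "x \<le> ?p" using True by auto
        ultimately have x: "x \<ge> 1" "x \<le> ?p" by linarith+
        have "g x \<le> g ?p" using g(1) x by (auto simp: mono_on_def)
        then have "g ?p powr (- 1 / real m) \<le> g x powr (- 1 / real m)"
          using g(2)[of x] x by (intro powr_mono2') auto
        moreover have "?p powr (1 / real m - 1) \<le> x powr (1 / real m - 1)"
          using x m by (intro powr_mono2') auto
        ultimately have "g ?p powr (- 1 / real m) * ?p powr (1 / real m - 1) \<le> f x"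
          unfolding f_def by (intro mult_mono) auto
        then show ?thesis using True x by (simp add: h_eq ennreal_leI)
      qed simp
    qed
    also have "\<dots> = emeasure N {2 ^ k<..?p}" by (simp add: N)
    finally show ?thesis .
  qed
  have sums: "ennreal (\<Sum>k<n. a (Suc k) / 2) \<le> emeasure N {1<..2 ^ n}" for n
  proof (induction n)
    case (Suc n)
    have "ennreal (\<Sum>k<Suc n. a (Suc k) / 2) = ennreal (\<Sum>k<n. a (Suc k) / 2) + ennreal (a (Suc n) / 2)"
      unfolding sum.lessThan_Suc using a0 by (intro ennreal_plus sum_nonneg) auto
    also have "\<dots> \<le> emeasure N {1<..2 ^ n} + emeasure N {2 ^ n<..2 ^ Suc n}"
      by (intro add_mono Suc step)
    also have "\<dots> = emeasure N ({1<..2 ^ n} \<union> {2 ^ n<..2 ^ Suc n})"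
      by (rule plus_emeasure) (auto simp: N_def)
    also have "{1<..2 ^ n} \<union> {2 ^ n<..2 ^ Suc n} = {1<..(2::real) ^ Suc n}"
      by (subst ivl_disj_un_two(6)) auto
    finally show ?case .
  qed simp
  define T where "T = enn2real (emeasure N {1..})"
  have "emeasure N {1..} = (\<integral>\<^sup>+ \<zeta> \<in> {1..}. ennreal (f \<zeta>) \<partial>lborel)"
    unfolding N[of "{1..}", simplified] h_eq by (intro nn_integral_cong) (auto simp: indicator_def)
  with fin have T: "emeasure N {1..} = ennreal T" 
    unfolding T_def f_def by (simp add: less_top[symmetric])
  have "(\<Sum>k<n. a (Suc k) / 2) \<le> T" for n
  proof -
    have "ennreal (\<Sum>k<n. a (Suc k) / 2) \<le> emeasure N {1..}"
      by (rule order_trans[OF sums emeasure_mono]) (auto simp: N_def)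
    then show ?thesis
      unfolding T by (subst (asm) ennreal_le_iff) (auto simp: T_def)
  qed
  then have "summable (\<lambda>k. a (Suc k) / 2)"
    by (intro summableI_nonneg_bounded) (auto simp: a0)
  from summable_mult[OF this, of 2] have "summable (\<lambda>k. a (Suc k))" by simp
  then show ?thesis unfolding a_def[symmetric] by (simp only: summable_Suc_iff)
qed

text \<open>From level \<open>e k\<close> at radius \<open>\<rho> k\<close>, a step of length
  \<open>d k\<close> brings the argument of \<open>g\<close> up to 2^k and so lifts \<open>E\<close>
  to the next level. The steps are summable and all fit below 2R, while the levels are
  unbounded.\<close>

lemma finite_time_blow_up:
  fixes E g :: "real \<Rightarrow> real"
  assumes m: "m \<ge> 1" and C: "C > 0" and e0: "e0 > 0"
    and g: "mono_on {0..} g" "\<And>t. t > 0 \<Longrightarrow> g t > 0"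
    and E: "mono E"
    and growth: "\<And>r R. 0 < r \<Longrightarrow> r < R \<Longrightarrow> 0 < E r \<Longrightarrow>
        (2 * R) ^ n * g ((R - r) ^ m * E r / (C * (2 * R) ^ n)) \<le> E R"
    and summ: "summable (\<lambda>k. (2 ^ k / g (2 ^ k)) powr (1 / real m))"
    and start: "\<And>K. \<exists>R>K. e0 * (4 * R) ^ n \<le> E R"
  shows False
proof -
  \<comment> \<open>Levels of \<open>E\<close> in units of \<open>V\<close>. After the start, level
    k is given by g (2^(k - 1)); the divisor 2^n absorbs the volume ratio of the cubes of half-sides
    R and 2R.\<close>
  define e where "e = (\<lambda>k. case k of 0 \<Rightarrow> e0 | Suc k \<Rightarrow> g (2 ^ k) / 2 ^ n)"
  have e_pos: "e k > 0" for k
    using e0 g(2) by (auto simp: e_def split: nat.split)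
  \<comment> \<open>The length for which (d k)^m * e k / C equals 2^k.\<close>
  define d where "d = (\<lambda>k. (C * 2 ^ k / e k) powr (1 / real m))"
  have d_pos: "d k > 0" for k using C e_pos[of k] by (simp add: d_def)
  have d_power: "d k ^ m = C * 2 ^ k / e k" for k
    using m C e_pos[of k] by (simp add: d_def powr_realpow[symmetric] powr_powr)
  have "d (Suc k) = (2 * C * 2 ^ n) powr (1 / real m) * (2 ^ k / g (2 ^ k)) powr (1 / real m)" for k
    using C g(2)[of "2 ^ k"] by (simp add: d_def e_def powr_mult[symmetric] mult_ac)
  then have "summable (\<lambda>k. d (Suc k))" using summable_mult[OF summ] by simp
  then have sd: "summable d" by (simp only: summable_Suc_iff)
  \<comment> \<open>Starting beyond the total length of all steps keeps every radius in [R, 2R), so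
    all cube volumes are at most \<open>V\<close>.\<close>
  obtain R where R: "R > suminf d" "e0 * (4 * R) ^ n \<le> E R" using start by blast
  have "suminf d \<ge> 0" using sd d_pos by (intro suminf_nonneg) (auto intro: less_imp_le)
  with R have R0: "R > 0" by linarith
  define \<rho> where "\<rho> = (\<lambda>k. R + (\<Sum>j<k. d j))"
  have \<rho>: "R \<le> \<rho> k" "\<rho> k < 2 * R" for k
  proof -
    have "(\<Sum>j<k. d j) \<le> suminf d"
      using sd d_pos by (intro sum_le_suminf) (auto intro: less_imp_le)
    then show "\<rho> k < 2 * R" using R by (simp add: \<rho>_def)
    show "R \<le> \<rho> k" using d_pos by (simp add: \<rho>_def sum_nonneg less_imp_le)
  qed
  define V where "V = (4 * R) ^ n"
  have V: "V > 0" using R0 by (simp add: V_def)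
  have low: "e k * V \<le> E (\<rho> k)" for k
  proof (induction k)
    case 0
    then show ?case using R by (simp add: \<rho>_def e_def V_def)
  next
    case (Suc k)
    define W where "W = (2 * \<rho> (Suc k)) ^ n"
    have WV: "W \<le> V" unfolding W_def V_def using \<rho>[of "Suc k"] R0 by (intro power_mono) auto
    have "V / 2 ^ n = (2 * R) ^ n" unfolding V_def power_divide[symmetric] by simp
    also have "\<dots> \<le> W" unfolding W_def using \<rho>[of "Suc k"] R0 by (intro power_mono) auto
    finally have VW: "V / 2 ^ n \<le> W" .
    with V have W: "W > 0" by (smt (verit) divide_pos_pos zero_less_power)
    have Epos: "E (\<rho> k) > 0" using Suc e_pos[of k] V by (smt (verit) mult_pos_pos)
    \<comment> \<open>Since W \<le> V, the level also holds relative to the outer volume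
      \<open>W\<close>, which makes the argument of \<open>g\<close> at least 2^k.\<close>
    have "e k * W \<le> E (\<rho> k)" using Suc WV e_pos[of k] by (smt (verit) mult_left_mono)
    then have "C * 2 ^ k / e k * (e k * W) \<le> C * 2 ^ k / e k * E (\<rho> k)"
      using C e_pos[of k] by (intro mult_left_mono) auto
    then have "2 ^ k \<le> d k ^ m * E (\<rho> k) / (C * W)"
      using C W e_pos[of k] by (simp add: d_power field_simps)
    then have "g (2 ^ k) \<le> g (d k ^ m * E (\<rho> k) / (C * W))"
      using g(1) by (smt (verit) atLeast_iff mono_on_def zero_le_power)
    then have "V / 2 ^ n * g (2 ^ k) \<le> W * g (d k ^ m * E (\<rho> k) / (C * W))"
      using VW W V g(2)[of "2 ^ k"] by (intro mult_mono) auto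
    also have "\<dots> \<le> E (\<rho> (Suc k))"
      using growth[of "\<rho> k" "\<rho> (Suc k)"] \<rho>[of k] R0 d_pos[of k] Epos by (simp add: W_def \<rho>_def)
    finally show ?case by (simp add: e_def mult_ac)
  qed
  have up: "g (2 ^ k) \<le> E (2 * R) * 2 ^ n / V" for k
  proof -
    have "g (2 ^ k) / 2 ^ n * V \<le> E (\<rho> (Suc k))" using low[of "Suc k"] by (simp add: e_def)
    also have "\<dots> \<le> E (2 * R)" using E \<rho>[of "Suc k"] by (simp add: monoD)
    finally show ?thesis using V by (simp add: field_simps)
  qed
  \<comment> \<open>Terms of a convergent series fall below 1, so g (2^k) is eventually at least 2^k
    and cannot stay bounded.\<close>
  have "(\<lambda>k. (2 ^ k / g (2 ^ k)) powr (1 / real m)) \<longlonglongrightarrow> 0"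
    using summ by (rule summable_LIMSEQ_zero)
  then have "eventually (\<lambda>k. (2 ^ k / g (2 ^ k)) powr (1 / real m) < 1) sequentially"
    by (rule order_tendstoD) simp
  then obtain k0 where k0: "\<And>k. k \<ge> k0 \<Longrightarrow> (2 ^ k / g (2 ^ k)) powr (1 / real m) < 1"
    by (auto simp: eventually_sequentially)
  have big: "2 ^ k \<le> g (2 ^ k)" if "k \<ge> k0" for k
  proof (rule ccontr)
    assume "\<not> ?thesis"
    then have "1 \<le> 2 ^ k / g (2 ^ k)" using g(2)[of "2 ^ k"] by simp
    then have "1 \<le> (2 ^ k / g (2 ^ k)) powr (1 / real m)" by (rule ge_one_powr_ge_zero) simp
    with k0[OF that] show False by simp
  qed
  obtain k where k: "E (2 * R) * 2 ^ n / V < 2 ^ k" using real_arch_pow[of 2] by auto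
  have "(2::real) ^ k \<le> 2 ^ (max k k0)" by (intro power_increasing) auto
  with big[of "max k k0"] up[of "max k k0"] k show False by simp
qed

section \<open>The integral condition at the origin\<close>

text \<open>If \<open>\<xi>\<close> came arbitrarily close to 0, its descending steps would cover
  (0, \<xi> 0]. Over each of them the integral of g(r) / r^(1+p) is at most a multiple of the drop
  in E^(1-p), and these drops telescope to a finite sum.\<close>

lemma discrete_lower_barrier:
  fixes g :: "real \<Rightarrow> real" and E \<xi> :: "nat \<Rightarrow> real"
  assumes g: "mono_on {0..} g" "\<And>t. t > 0 \<Longrightarrow> g t > 0" and p: "p > 1"
    and div: "(\<integral>\<^sup>+ r \<in> {0<..1}. ennreal (g r / r powr (1 + p)) \<partial>lborel) = \<infinity>"
    and E: "E 0 > 0" "incseq E" and \<xi>: "\<And>j. \<xi> j > 0" and l: "l > 0" and B: "B \<ge> 0"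
    and ratio: "\<And>j. \<xi> j / \<xi> (Suc j) = l * E j / E (Suc j)"
    and growth: "\<And>j. g (\<xi> j) \<le> B * (E (Suc j) - E j) * (\<xi> j / E j) powr p"
  shows "\<exists>\<delta>>0. \<forall>j. \<delta> \<le> \<xi> j"
proof (rule ccontr)
  assume "\<not> ?thesis"
  then have small: "\<exists>j. \<xi> j < \<delta>" if "\<delta> > 0" for \<delta> using that by (auto simp: not_le)
  have Epos: "E j > 0" for j using E by (metis incseqD less_le_trans zero_le)
  have Emono: "E j \<le> E (Suc j)" for j using E(2) by (simp add: incseq_SucD)
  define q where "q = p - 1"
  have q: "q > 0" using p by (simp add: q_def)
  have gm: "(\<lambda>x. indicator {0<..} x * g x) \<in> borel_measurable borel"
  proof -
    have "g \<in> borel_measurable (restrict_space borel {0<..})"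
      by (rule borel_measurable_mono_on_fnc) (rule mono_on_subset[OF g(1)], auto)
    then show ?thesis by (subst (asm) borel_measurable_restrict_space_iff) auto
  qed
  define h where "h = (\<lambda>x. ennreal ((indicator {0<..} x * g x) / x powr (1 + p)))"
  have h: "h \<in> borel_measurable borel" unfolding h_def using gm by measurable
  have h_eq: "h x = ennreal (g x / x powr (1 + p))" if "x > 0" for x
    using that by (simp add: h_def)
  define N where "N = density lborel h"
  have setsN[simp]: "sets N = sets borel" by (simp add: N_def)
  have N: "emeasure N S = (\<integral>\<^sup>+ x. h x * indicator S x \<partial>lborel)" if "S \<in> sets borel" for S
    using that h by (simp add: N_def emeasure_density)
  have N_le: "emeasure N {x<..y} \<le> ennreal (g y * x powr (- 1 - p) * y)" if "0 < x" "x \<le> y" for x y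
  proof -
    have gy: "g y > 0" using g that by auto
    have "emeasure N {x<..y} = (\<integral>\<^sup>+ t. h t * indicator {x<..y} t \<partial>lborel)" by (simp add: N)
    also have "\<dots> \<le> (\<integral>\<^sup>+ t. ennreal (g y * x powr (- 1 - p)) * indicator {x<..y} t \<partial>lborel)"
    proof (rule nn_integral_mono)
      fix t
      show "h t * indicator {x<..y} t \<le> ennreal (g y * x powr (- 1 - p)) * indicator {x<..y} t"
      proof (cases "t \<in> {x<..y}")
        case True
        have "g t / t powr (1 + p) = g t * t powr (- 1 - p)"
          using powr_minus_divide[of t "1 + p"] by simp
        also have "\<dots> \<le> g y * x powr (- 1 - p)"
          using True that p g(1) g(2)[of t]
          by (intro mult_mono powr_mono2') (auto simp: mono_on_def intro: less_imp_le[OF g(2)])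
        finally show ?thesis using True that by (simp add: h_eq ennreal_leI)
      qed simp
    qed
    also have "\<dots> = ennreal (g y * x powr (- 1 - p)) * ennreal (y - x)"
      using that by (simp add: nn_integral_cmult_indicator)
    also have "\<dots> \<le> ennreal (g y * x powr (- 1 - p)) * ennreal y"
      using that by (intro mult_left_mono ennreal_leI) auto
    also have "\<dots> = ennreal (g y * x powr (- 1 - p) * y)"
      using that gy by (intro ennreal_mult[symmetric]) auto
    finally show ?thesis .
  qed
  define K where "K = B * l powr (1 + p) / q"
  have K: "K \<ge> 0" using B q by (simp add: K_def)
  have decr: "E (Suc j) powr - q \<le> E j powr - q" for j
    using Epos[of j] Emono[of j] q by (intro powr_mono2') auto
  have decr0: "E j powr - q \<le> E 0 powr - q" for j
    using E(1) E(2) q by (intro powr_mono2') (auto simp: incseq_def)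
  have step: "emeasure N {\<xi> (Suc j)<..\<xi> j} \<le> ennreal (K * (E j powr - q - E (Suc j) powr - q))"
    if "\<xi> (Suc j) < \<xi> j" for j
  proof -
    define x y a b where "x = \<xi> (Suc j)" and "y = \<xi> j" and "a = E j" and "b = E (Suc j)"
    have pos: "x > 0" "y > 0" "a > 0" "b > 0" "a \<le> b"
      using \<xi> Epos Emono by (auto simp: x_def y_def a_def b_def)
    \<comment> \<open>Inserting this quotient of endpoints turns the powers of \<open>\<xi>\<close>
      into powers of \<open>E\<close>, ready for \<open>powr_telescope\<close>.\<close>
    have yx: "y / x = l * a / b" using ratio[of j] by (simp add: x_def y_def a_def b_def)
    have "g y * x powr (- 1 - p) * y \<le> B * (b - a) * (y / a) powr p * x powr (- 1 - p) * y"
      using growth[of j] pos by (intro mult_right_mono) (auto simp: x_def y_def a_def b_def)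
    also have "\<dots> = B * (b - a) * ((y / x) powr (1 + p) * a powr - p)"
      using pos by (simp add: powr_divide powr_minus_divide powr_add powr_diff field_simps)
    also have "(y / x) powr (1 + p) * a powr - p = l powr (1 + p) * (a * b powr (- 1 - p))"
      unfolding yx using pos l by (simp add: powr_divide powr_mult powr_minus_divide powr_add powr_diff field_simps)
    also have "B * (b - a) * (l powr (1 + p) * (a * b powr (- 1 - p))) \<le>
        B * (b - a) * (l powr (1 + p) * (b * b powr (- 1 - p)))"
      using pos l B by (intro mult_left_mono mult_right_mono) auto
    also have "\<dots> = B * l powr (1 + p) * ((b - a) * b powr (- 1 - q))"
      using pos by (simp add: q_def powr_diff powr_minus_divide field_simps)
    also have "\<dots> \<le> B * l powr (1 + p) * ((a powr - q - b powr - q) / q)"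
      using pos q B by (intro mult_left_mono powr_telescope) auto
    also have "\<dots> = K * (a powr - q - b powr - q)" by (simp add: K_def)
    finally have "g y * x powr (- 1 - p) * y \<le> K * (a powr - q - b powr - q)" .
    then show ?thesis
      using N_le[of x y] pos that unfolding x_def y_def a_def b_def
      by (meson ennreal_leI less_imp_le order_trans)
  qed
  have bound: "emeasure N {\<xi> j<..\<xi> 0} \<le> ennreal (K * (E 0 powr - q - E j powr - q))" for j
  proof (induction j)
    case (Suc j)
    show ?case
    proof (cases "\<xi> (Suc j) < \<xi> j")
      case True
      have "emeasure N {\<xi> (Suc j)<..\<xi> 0} \<le> emeasure N ({\<xi> j<..\<xi> 0} \<union> {\<xi> (Suc j)<..\<xi> j})"
        by (rule emeasure_mono) auto
      also have "\<dots> \<le> emeasure N {\<xi> j<..\<xi> 0} + emeasure N {\<xi> (Suc j)<..\<xi> j}"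
        by (rule emeasure_subadditive) auto
      also have "\<dots> \<le> ennreal (K * (E 0 powr - q - E j powr - q)) + ennreal (K * (E j powr - q - E (Suc j) powr - q))"
        by (intro add_mono Suc step True)
      also have "\<dots> = ennreal (K * (E 0 powr - q - E j powr - q) + K * (E j powr - q - E (Suc j) powr - q))"
        using K decr[of j] decr0[of j] by (intro ennreal_plus[symmetric] mult_nonneg_nonneg) auto
      also have "K * (E 0 powr - q - E j powr - q) + K * (E j powr - q - E (Suc j) powr - q) =
          K * (E 0 powr - q - E (Suc j) powr - q)"
        by (simp add: right_diff_distrib)
      finally show ?thesis .
    next
      \<comment> \<open>An upward step shrinks the interval, while the bound only grows.\<close>
      case False
      then have "emeasure N {\<xi> (Suc j)<..\<xi> 0} \<le> emeasure N {\<xi> j<..\<xi> 0}"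
        by (intro emeasure_mono) auto
      also note Suc
      also have "ennreal (K * (E 0 powr - q - E j powr - q)) \<le> ennreal (K * (E 0 powr - q - E (Suc j) powr - q))"
        using K decr[of j] by (intro ennreal_leI mult_left_mono) auto
      finally show ?thesis .
    qed
  qed simp
  \<comment> \<open>These sets exhaust (0, \<xi> 0], and each lies in an interval covered by
    \<open>bound\<close>, because some \<open>\<xi> j\<close> is below 1 / (i + 1).\<close>
  define A where "A = (\<lambda>i. {1 / real (Suc i)<..\<xi> 0})"
  have "emeasure N (A i) \<le> ennreal (K * E 0 powr - q)" for i
  proof -
    obtain j where "\<xi> j < 1 / real (Suc i)" using small[of "1 / real (Suc i)"] by auto
    then have "emeasure N (A i) \<le> emeasure N {\<xi> j<..\<xi> 0}"
      by (intro emeasure_mono) (auto simp: A_def)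
    also note bound[of j]
    also have "ennreal (K * (E 0 powr - q - E j powr - q)) \<le> ennreal (K * E 0 powr - q)"
      using K by (intro ennreal_leI mult_left_mono) auto
    finally show ?thesis .
  qed
  then have "(SUP i. emeasure N (A i)) \<le> ennreal (K * E 0 powr - q)"
    by (intro SUP_least)
  moreover have "(SUP i. emeasure N (A i)) = emeasure N (\<Union>i. A i)"
  proof (rule SUP_emeasure_incseq)
    show "incseq A"
    proof (rule monoI)
      fix i j :: nat assume "i \<le> j"
      then have "1 / real (Suc j) \<le> 1 / real (Suc i)" by (simp add: frac_le)
      then show "A i \<subseteq> A j" by (auto simp: A_def)
    qed
  qed (auto simp: A_def)
  moreover have "{0<..\<xi> 0} \<subseteq> (\<Union>i. A i)"
  proof
    fix x assume x: "x \<in> {0<..\<xi> 0}"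
    then obtain i where "inverse (real (Suc i)) < x" using reals_Archimedean[of x] by auto
    with x show "x \<in> (\<Union>i. A i)" by (auto simp: A_def inverse_eq_divide)
  qed
  then have "emeasure N {0<..\<xi> 0} \<le> emeasure N (\<Union>i. A i)"
    by (rule emeasure_mono) (auto simp: A_def)
  ultimately have fin1: "emeasure N {0<..\<xi> 0} < \<infinity>"
    by (metis ennreal_less_top infinity_ennreal_def order_le_less_trans)
  have fin2: "emeasure N {\<xi> 0<..1} < \<infinity>"
  \<comment> \<open>Away from 0 the integrand is bounded; for \<xi> 0 > 1 the interval is
    empty.\<close>
  proof (cases "\<xi> 0 \<le> 1")
    case True
    from N_le[OF \<xi> this] show ?thesis by (rule order_le_less_trans) simp
  qed simp
  have "emeasure N {0<..1} \<le> emeasure N ({0<..\<xi> 0} \<union> {\<xi> 0<..1})"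
    by (rule emeasure_mono) auto
  also have "\<dots> \<le> emeasure N {0<..\<xi> 0} + emeasure N {\<xi> 0<..1}"
    by (rule emeasure_subadditive) auto
  also have "\<dots> < \<infinity>" using fin1 fin2 by simp
  finally have "emeasure N {0<..1} < \<infinity>" .
  moreover have "emeasure N {0<..1} = (\<integral>\<^sup>+ r \<in> {0<..1}. ennreal (g r / r powr (1 + p)) \<partial>lborel)"
    unfolding N[of "{0<..1}", simplified]
    by (intro nn_integral_cong) (auto simp: indicator_def h_eq)
  ultimately show False using div by simp
qed

section \<open>Triviality of weak solutions\<close>

lemma measure_cube_diff:
  assumes "0 \<le> r" "r \<le> R"
  shows "measure lebesgue (cube R - cube r :: (real ^ 'n::finite) set) = (2 * R) ^ CARD('n) - (2 * r) ^ CARD('n)"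
  using assms measurable_measure_Diff[OF lmeasurable_cube fmeasurableD[OF lmeasurable_cube] cube_mono, of r R]
  by (simp add: measure_cube)

theorem theorem2p1:
  fixes m :: nat and A :: real
    and a :: "('n::finite \<Rightarrow> nat) \<Rightarrow> real ^ 'n \<Rightarrow> real \<Rightarrow> real"
    and g :: "real \<Rightarrow> real" and u :: "real ^ 'n \<Rightarrow> real"
  assumes "m \<ge> 1" and "CARD('n) > m" and "A > 0"
    and "\<And>\<alpha>. mi_size \<alpha> = m \<Longrightarrow> caratheodory (a \<alpha>)"
    and "\<And>\<alpha>. mi_size \<alpha> = m \<Longrightarrow> (AE x in lebesgue. \<forall>\<zeta>. \<bar>a \<alpha> x \<zeta>\<bar> \<le> A * \<bar>\<zeta>\<bar>)"
    and "mono_on {0..} g" and "convex_on {0..} g" and "\<And>\<zeta>. \<zeta> > 0 \<Longrightarrow> g \<zeta> > 0"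
    and "(\<integral>\<^sup>+ \<zeta> \<in> {1..}. ennreal (g \<zeta> powr (- 1 / real m) * \<zeta> powr (1 / real m - 1)) \<partial>lborel) < \<infinity>"
    and "(\<integral>\<^sup>+ r \<in> {0<..1}. ennreal (g r / r powr (1 + real CARD('n) / (real CARD('n) - real m))) \<partial>lborel) = \<infinity>"
    and "global_weak_solution m a g u"
  shows "AE x in lebesgue. u x = 0"
proof (rule ccontr)
  assume nontrivial: "\<not> ?thesis"
  note m = assms(1) and mn = assms(2) and g_mono = assms(6) and g_convex = assms(7) and g_pos = assms(8)
  define n where "n = CARD('n)"
  have g_nonneg: "g t \<ge> 0" if "t \<ge> 0" for t
    using convex_mono_nonneg[OF g_convex g_mono g_pos that] .
  obtain C where C: "C > 0" and annulus: "\<And>r R. 0 < r \<Longrightarrow> r < R \<Longrightarrow>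
      (R - r) ^ m * (LINT x:cube r|lebesgue. g \<bar>u x\<bar>) \<le> C * (LINT x:cube R - cube r|lebesgue. \<bar>u x\<bar>)"
    using weak_solution_annulus_estimate[OF assms(1,3,5) g_nonneg assms(11)] by metis
  have u_int: "set_integrable lebesgue (cube r) u"
    and gu_int: "set_integrable lebesgue (cube r) (\<lambda>x. g \<bar>u x\<bar>)" for r
    using assms(11) compact_cube[of r] unfolding global_weak_solution_def L1_loc_def by auto
  have annulus_lm: "cube R - cube r \<in> lmeasurable" for r R :: real
    by (intro fmeasurable.Diff lmeasurable_cube)
  have u_int': "set_integrable lebesgue (cube R - cube r) u"
    and gu_int': "set_integrable lebesgue (cube R - cube r) (\<lambda>x. g \<bar>u x\<bar>)" for r R
    by (rule set_integrable_subset[OF u_int[of R]] set_integrable_subset[OF gu_int[of R]];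
        use annulus_lm in auto)+
  define E where "E = (\<lambda>r. LINT x:cube r|lebesgue. g \<bar>u x\<bar>)"
  have E_diff: "E R - E r = (LINT x:cube R - cube r|lebesgue. g \<bar>u x\<bar>)" if "r \<le> R" for r R
  proof -
    have "cube r \<subseteq> (cube R :: (real ^ 'n) set)" by (rule cube_mono[OF that])
    then have "E R = (LINT x:(cube R - cube r) \<union> cube r|lebesgue. g \<bar>u x\<bar>)"
      unfolding E_def by (simp add: Un_absorb2)
    also have "\<dots> = (LINT x:cube R - cube r|lebesgue. g \<bar>u x\<bar>) + E r"
      unfolding E_def by (rule set_integral_Un[OF _ gu_int' gu_int]) auto
    finally show ?thesis by simp
  qed
  have E_mono: "mono E"
  proof (rule monoI)
    fix r R :: real assume "r \<le> R"
    moreover have "(LINT x:cube R - cube r|lebesgue. g \<bar>u x\<bar>) \<ge> 0"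
      unfolding set_lebesgue_integral_def using g_nonneg by (intro integral_nonneg_AE AE_I2) auto
    ultimately show "E r \<le> E R" using E_diff[of r R] by linarith
  qed
  have E_nonneg: "E r \<ge> 0" for r
    unfolding E_def set_lebesgue_integral_def using g_nonneg by (intro integral_nonneg_AE AE_I2) auto
  \<comment> \<open>If \<open>E\<close> vanished at all integers, g(|u|) would vanish almost
    everywhere, and positivity of \<open>g\<close> off 0 would force u = 0.\<close>
  obtain k :: nat where k: "E (real k) \<noteq> 0"
  proof (rule ccontr)
    assume "\<not> thesis"
    with that have "E (real k) = 0" for k by blast
    then have "AE x in lebesgue. indicator (cube (real k)) x *\<^sub>R g \<bar>u x\<bar> = 0" for k
      using gu_int[of "real k"] unfolding E_def set_lebesgue_integral_def set_integrable_def
      by (intro integral_nonneg_eq_0_iff_AE[THEN iffD1] AE_I2) (simp_all add: g_nonneg)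
    then have "AE x in lebesgue. \<forall>k. indicator (cube (real k)) x *\<^sub>R g \<bar>u x\<bar> = 0"
      unfolding AE_all_countable by blast
    then have "AE x in lebesgue. u x = 0"
    proof eventually_elim
      case (elim x)
      obtain k where k: "norm x < real k" using reals_Archimedean2 by blast
      have "x \<in> cube (real k)"
        using k component_le_norm_cart[of x] unfolding cube_def by (auto intro: order_trans less_imp_le)
      with elim[rule_format, of k] have "g \<bar>u x\<bar> = 0" by simp
      then show ?case using g_pos[of "\<bar>u x\<bar>"] by auto
    qed
    with nontrivial show False by simp
  qed
  define r0 where "r0 = real k + 1"
  have r0: "r0 > 0" "E r0 > 0"
    using monoD[OF E_mono, of "real k" r0] k E_nonneg[of "real k"] by (auto simp: r0_def)
  \<comment> \<open>Jensen on the annulus controls the increment of \<open>E\<close> and serves the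
    dyadic stage. Jensen on the whole cube keeps the volume comparable when R - r is small and
    serves the blow-up.\<close>
  have grow_annulus: "((2 * R) ^ n - (2 * r) ^ n) * g ((R - r) ^ m * E r / (C * ((2 * R) ^ n - (2 * r) ^ n))) \<le> E R - E r"
    and grow_cube: "(2 * R) ^ n * g ((R - r) ^ m * E r / (C * (2 * R) ^ n)) \<le> E R"
    if r: "0 < r" "r < R" "0 < E r" for r R
  proof -
    have "(2 * r) ^ n < (2 * R) ^ n"
      using r mn by (intro power_strict_mono) (auto simp: n_def)
    then have V: "(2 * R) ^ n - (2 * r) ^ n > 0" by simp
    have W: "(2 * R) ^ n > 0" using r by simp
    have est: "(R - r) ^ m * E r \<le> C * (LINT x:cube R - cube r|lebesgue. \<bar>u x\<bar>)"
      using annulus[OF r(1,2)] by (simp only: E_def)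
    show "((2 * R) ^ n - (2 * r) ^ n) * g ((R - r) ^ m * E r / (C * ((2 * R) ^ n - (2 * r) ^ n))) \<le> E R - E r"
    proof -
      have "measure lebesgue (cube R - cube r :: (real ^ 'n) set) = (2 * R) ^ n - (2 * r) ^ n"
        using measure_cube_diff[of r R] r by (simp add: n_def)
      from convex_integral_lower_bound_divide[OF g_convex g_mono annulus_lm u_int' gu_int' this V C _ est]
      show ?thesis using r E_diff[of r R] by simp
    qed
    have "(LINT x:cube R - cube r|lebesgue. \<bar>u x\<bar>) \<le> (LINT x:cube R|lebesgue. \<bar>u x\<bar>)"
      using set_integrable_abs[OF u_int[of R]] set_integrable_abs[OF u_int'[of R r]]
      unfolding set_lebesgue_integral_def set_integrable_def
      by (intro integral_mono) (auto simp: indicator_def)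
    with est C have "(R - r) ^ m * E r \<le> C * (LINT x:cube R|lebesgue. \<bar>u x\<bar>)"
      by (smt (verit) mult_left_mono)
    moreover have "measure lebesgue (cube R :: (real ^ 'n) set) = (2 * R) ^ n"
      using measure_cube[of R] r by (simp add: n_def)
    moreover have "E R = (LINT x:cube R|lebesgue. g \<bar>u x\<bar>)" by (simp only: E_def)
    ultimately show "(2 * R) ^ n * g ((R - r) ^ m * E r / (C * (2 * R) ^ n)) \<le> E R"
      using convex_integral_lower_bound_divide[OF g_convex g_mono lmeasurable_cube u_int gu_int _ W C,
          of R "(R - r) ^ m * E r"] r by simp
  qed
  \<comment> \<open>The exponent with (m - n) * p = - n.\<close>
  define p where "p = real n / (real n - real m)"
  \<comment> \<open>The annulus between half-sides r and 2r has volume \<kappa> * r^n.\<close>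
  define \<kappa> where "\<kappa> = (4 ^ n - 2 ^ n :: real)"
  have \<kappa>: "\<kappa> > 0" using mn by (simp add: \<kappa>_def n_def power_strict_mono)
  have p: "p > 1" using m mn by (simp add: p_def n_def)
  define \<rho> where "\<rho> = (\<lambda>j::nat. 2 ^ j * r0)"
  have \<rho>: "\<rho> j > 0" "\<rho> (Suc j) = 2 * \<rho> j" for j using r0 by (auto simp: \<rho>_def)
  have \<rho>_inc: "incseq \<rho>" using \<rho> by (intro incseq_SucI) (simp add: less_imp_le)
  have E\<rho>: "E (\<rho> j) > 0" for j
    using incseqD[OF \<rho>_inc, of 0 j] monoD[OF E_mono, of r0 "\<rho> j"] r0 by (simp add: \<rho>_def)
  define \<xi> where "\<xi> = (\<lambda>j. \<rho> j ^ m * E (\<rho> j) / (C * (\<kappa> * \<rho> j ^ n)))"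
  have \<xi>: "\<xi> j > 0" for j
    unfolding \<xi>_def using C \<kappa> \<rho>(1) E\<rho> by (intro divide_pos_pos mult_pos_pos zero_less_power)
  have dyadic: "\<kappa> * \<rho> j ^ n * g (\<xi> j) \<le> E (\<rho> (Suc j)) - E (\<rho> j)" for j
  proof -
    have "(2 * \<rho> (Suc j)) ^ n - (2 * \<rho> j) ^ n = (4 * \<rho> j) ^ n - (2 * \<rho> j) ^ n"
      by (simp add: \<rho>(2))
    also have "\<dots> = \<kappa> * \<rho> j ^ n"
      unfolding \<kappa>_def power_mult_distrib by (rule left_diff_distrib[symmetric])
    finally have "(2 * \<rho> (Suc j)) ^ n - (2 * \<rho> j) ^ n = \<kappa> * \<rho> j ^ n" .
    moreover have "\<rho> (Suc j) - \<rho> j = \<rho> j" by (simp add: \<rho>)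
    ultimately show ?thesis
      using grow_annulus[of "\<rho> j" "\<rho> (Suc j)"] \<rho>[of j] E\<rho>[of j] by (simp add: \<xi>_def)
  qed
  have "\<exists>\<delta>>0. \<forall>j. \<delta> \<le> \<xi> j"
  proof (rule discrete_lower_barrier[OF g_mono g_pos p])
    show "(\<integral>\<^sup>+ r \<in> {0<..1}. ennreal (g r / r powr (1 + p)) \<partial>lborel) = \<infinity>"
      using assms(10) by (simp add: p_def n_def)
    show "E (\<rho> 0) > 0" by (rule E\<rho>)
    show "incseq (\<lambda>j. E (\<rho> j))"
      using E_mono \<rho>_inc by (auto simp: incseq_def mono_def)
    show "\<xi> j > 0" for j by (rule \<xi>)
    \<comment> \<open>\<open>\<xi> j\<close> is a multiple of \<rho>^(m - n) * E, so doubling the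
      radius contributes the factor 2^(n - m) to the ratio.\<close>
    show "(2 ^ n / 2 ^ m :: real) > 0" by simp
    show "(C * \<kappa>) powr p / \<kappa> \<ge> 0" using \<kappa> by simp
    show "\<xi> j / \<xi> (Suc j) = 2 ^ n / 2 ^ m * E (\<rho> j) / E (\<rho> (Suc j))" for j
      using \<rho>(1)[of j] E\<rho>[of j] E\<rho>[of "Suc j"] C \<kappa>
      by (simp add: \<xi>_def \<rho>(2) power_mult_distrib field_simps)
    show "g (\<xi> j) \<le> (C * \<kappa>) powr p / \<kappa> * (E (\<rho> (Suc j)) - E (\<rho> j)) * (\<xi> j / E (\<rho> j)) powr p" for j
    proof -
      \<comment> \<open>The p-th power of this quotient is a multiple of \<rho>^(-n), the reciprocal
        of the annulus volume up to a constant; this is what ties the exponent in the condition at 0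
        to n / (n - m).\<close>
      have "\<xi> j / E (\<rho> j) = \<rho> j powr (real m - real n) / (C * \<kappa>)"
        using \<rho>(1)[of j] E\<rho>[of j] C \<kappa> by (simp add: \<xi>_def powr_diff powr_realpow field_simps)
      then have "(\<xi> j / E (\<rho> j)) powr p = \<rho> j powr ((real m - real n) * p) / (C * \<kappa>) powr p"
        using \<rho>(1)[of j] C \<kappa> by (simp add: powr_divide powr_powr)
      also have "(real m - real n) * p = - real n"
        using mn by (simp add: p_def n_def field_simps)
      finally have eq: "(\<xi> j / E (\<rho> j)) powr p = 1 / (\<rho> j ^ n * (C * \<kappa>) powr p)"
        using \<rho>(1)[of j] by (simp add: powr_minus powr_realpow field_simps)
      have "g (\<xi> j) \<le> (E (\<rho> (Suc j)) - E (\<rho> j)) / (\<kappa> * \<rho> j ^ n)"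
        using dyadic[of j] \<rho>(1)[of j] \<kappa> by (simp add: pos_le_divide_eq mult.commute)
      then show ?thesis
        unfolding eq using C \<kappa> by (simp add: mult_ac)    qed
  qed
  then obtain \<delta> where \<delta>: "\<delta> > 0" "\<And>j. \<delta> \<le> \<xi> j" by blast
  show False
  proof (rule finite_time_blow_up[OF m C _ g_mono g_pos E_mono grow_cube
        summable_dyadic[OF m g_mono g_pos assms(9)]])
    \<comment> \<open>As 4 * \<rho> (Suc j) = 8 * \<rho> j, the factor 8^n cancels and leaves the
      dyadic estimate with \<open>\<xi> j\<close> replaced by its lower bound
      \<open>\<delta>\<close>.\<close>
    show "\<kappa> * g \<delta> / 8 ^ n > 0" using \<kappa> g_pos \<delta> by simp
    show "\<exists>R>K. \<kappa> * g \<delta> / 8 ^ n * (4 * R) ^ n \<le> E R" for K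
    proof -
      obtain j where "K / r0 < 2 ^ j" using real_arch_pow[of 2] by auto
      then have "K < \<rho> j" using r0 by (simp add: \<rho>_def field_simps)
      then have "K < \<rho> (Suc j)" using \<rho>[of j] by simp
      moreover have "\<kappa> * g \<delta> / 8 ^ n * (4 * \<rho> (Suc j)) ^ n \<le> E (\<rho> (Suc j))"
      proof -
        have "g \<delta> \<le> g (\<xi> j)" using g_mono \<delta>(1) \<delta>(2)[of j] by (auto simp: mono_on_def)
        then have "\<kappa> * \<rho> j ^ n * g \<delta> \<le> \<kappa> * \<rho> j ^ n * g (\<xi> j)"
          using \<kappa> \<rho>(1)[of j] by (intro mult_left_mono) auto
        also have "\<dots> \<le> E (\<rho> (Suc j))" using dyadic[of j] E\<rho>[of j] by linarith
        finally show ?thesis by (simp add: \<rho> power_mult_distrib mult_ac)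
      qed
      ultimately show ?thesis by blast
    qed
  qed auto
qed

end
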